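(* For $a\in\mathcal P:=(\mathbb C\setminus\mathbb R)\cup(0,1)$, the Bott invariant of (the restriction to $TS^3$ of) $\omega^a=a z_1\,\mathrm dz_2-(1-a)z_2\,\mathrm dz_1$ equals $$\frac{-4\pi^2}{a(1-a)}.$$
   Context: $S^3\subset\mathbb C^2$ is the unit sphere with its standard orientation as the boundary of the unit ball. For $a\in\mathcal P$ the restriction of $\omega^a$ to $TS^3$ is a formally integrable complex $1$-form: its real and imaginary parts are pointwise linearly independent and $\omega^a\wedge\mathrm d\omega^a=0$. Bott invariant: for a formally integrable complex $1$-form $\omega_{\mathrm c}$ (complex-valued $1$-form with pointwise linearly independent real and imaginary parts and $\omega_{\mathrm c}\wedge\mathrm d\omega_{\mathrm c}=0$) on a closed, connected, oriented $3$-manifold $M$ there is a complex-valued $1$-form $\alpha_{\mathrm c}$ with $\mathrm d\omega_{\mathrm c}=\alpha_{\mathrm c}\wedge\omega_{\mathrm c}$, and the Bott invariant is the complex number $\int_M\alpha_{\mathrm c}\wedge\mathrm d\alpha_{\mathrm c}$, which is independent of the choice of $\alpha_{\mathrm c}$. *)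

theory Defs
  imports "HOL-Analysis.Analysis"
begin

text \<open>
  Manifolds are embedded submanifolds \<open>M\<close> of a Euclidean space. A differential form on \<open>M\<close> is
  given by a form on the ambient space that is smooth on some open neighbourhood of \<open>M\<close>; only its
  values on tangent vectors of \<open>M\<close> are ever used. Every smooth form on a closed submanifold
  arises in this way, and restriction to \<open>M\<close> commutes with wedge products and with the exterior
  derivative.
\<close>

subsection \<open>Smooth maps and forms\<close>

text \<open>The set \<open>U\<close> is meant to be open in the following definition.\<close>

primrec Ck_on :: "nat \<Rightarrow> 'a set \<Rightarrow> ('a::real_normed_vector \<Rightarrow> 'b::real_normed_vector) \<Rightarrow> bool" where
  "Ck_on 0 U f \<longleftrightarrow> continuous_on U f"
| "Ck_on (Suc k) U f \<longleftrightarrow>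
     f differentiable_on U \<and> (\<forall>v. Ck_on k U (\<lambda>x. frechet_derivative f (at x) v))"

definition smooth_on :: "'a set \<Rightarrow> ('a::real_normed_vector \<Rightarrow> 'b::real_normed_vector) \<Rightarrow> bool" where
  "smooth_on U f \<longleftrightarrow> open U \<and> (\<forall>k. Ck_on k U f)"

type_synonym 'a form1 = "'a \<Rightarrow> ('a \<Rightarrow>\<^sub>L complex)"
type_synonym 'a form2 = "'a \<Rightarrow> 'a \<Rightarrow> 'a \<Rightarrow> complex"
type_synonym 'a form3 = "'a \<Rightarrow> 'a \<Rightarrow> 'a \<Rightarrow> 'a \<Rightarrow> complex"

definition smooth_form :: "'a set \<Rightarrow> 'a::real_normed_vector form1 \<Rightarrow> bool" where
  "smooth_form M \<alpha> \<longleftrightarrow> (\<exists>U. M \<subseteq> U \<and> smooth_on U \<alpha>)"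

text \<open>
  In all forms the first argument is the base point. The convention for \<open>\<and>\<close> is the determinant
  one (no factors \<open>1/k!\<close>), and the exterior derivative is
  \<open>d\<alpha>(X,Y) = X(\<alpha>(Y)) - Y(\<alpha>(X)) - \<alpha>([X,Y])\<close>, evaluated on constant vector fields.
\<close>

definition ext_deriv :: "'a::real_normed_vector form1 \<Rightarrow> 'a form2" where
  "ext_deriv \<alpha> p u v =
     blinfun_apply (frechet_derivative \<alpha> (at p) u) v - blinfun_apply (frechet_derivative \<alpha> (at p) v) u"

definition wedge11 :: "'a::real_normed_vector form1 \<Rightarrow> 'a form1 \<Rightarrow> 'a form2" where
  "wedge11 \<alpha> \<beta> p u v = \<alpha> p u * \<beta> p v - \<alpha> p v * \<beta> p u"

definition wedge12 :: "'a::real_normed_vector form1 \<Rightarrow> 'a form2 \<Rightarrow> 'a form3" where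
  "wedge12 \<alpha> \<eta> p u v w = \<alpha> p u * \<eta> p v w - \<alpha> p v * \<eta> p u w + \<alpha> p w * \<eta> p u v"

subsection \<open>Tangent spaces and formal integrability\<close>

definition tangent_space :: "'a set \<Rightarrow> 'a \<Rightarrow> 'a::real_normed_vector set" where
  "tangent_space M p =
     {v. \<exists>\<gamma>::real \<Rightarrow> 'a. range \<gamma> \<subseteq> M \<and> \<gamma> 0 = p \<and> (\<gamma> has_vector_derivative v) (at 0)}"

definition formally_integrable :: "'a set \<Rightarrow> 'a::real_normed_vector form1 \<Rightarrow> bool" where
  "formally_integrable M \<omega> \<longleftrightarrow> smooth_form M \<omega> \<and>
     (\<forall>p\<in>M. \<forall>s t::real.
        (\<forall>v\<in>tangent_space M p. s * Re (\<omega> p v) + t * Im (\<omega> p v) = 0) \<longrightarrow> s = 0 \<and> t = 0) \<and>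
     (\<forall>p\<in>M. \<forall>u\<in>tangent_space M p. \<forall>v\<in>tangent_space M p. \<forall>w\<in>tangent_space M p.
        wedge12 \<omega> (ext_deriv \<omega>) p u v w = 0)"

subsection \<open>Integration of 3-forms over oriented 3-manifolds\<close>

text \<open>
  An orientation of a 3-manifold is given by a function \<open>Or\<close>: a basis \<open>u, v, w\<close> of the tangent
  space at \<open>p\<close> is positive iff \<open>Or p u v w > 0\<close>. A local parametrization \<open>\<phi>\<close> (inverse of a chart)
  is an immersion because the orientation is meant to be alternating, i.e. to vanish on linearly
  dependent triples.
\<close>

type_synonym 'a orientation = "'a \<Rightarrow> 'a \<Rightarrow> 'a \<Rightarrow> 'a \<Rightarrow> real"

definition oriented_param ::
  "'a set \<Rightarrow> 'a orientation \<Rightarrow> (real^3) set \<Rightarrow> (real^3 \<Rightarrow> 'a::real_normed_vector) \<Rightarrow> bool" where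
  "oriented_param M Or V \<phi> \<longleftrightarrow>
     smooth_on V \<phi> \<and> \<phi> ` V \<subseteq> M \<and> openin (top_of_set M) (\<phi> ` V) \<and>
     (\<exists>\<psi>. homeomorphism V (\<phi> ` V) \<phi> \<psi>) \<and>
     (\<forall>x\<in>V. 0 < Or (\<phi> x) (frechet_derivative \<phi> (at x) (axis 1 1))
                        (frechet_derivative \<phi> (at x) (axis 2 1))
                        (frechet_derivative \<phi> (at x) (axis 3 1)))"

definition pullback_coeff ::
  "(real^3 \<Rightarrow> 'a::real_normed_vector) \<Rightarrow> 'a form3 \<Rightarrow> real^3 \<Rightarrow> complex" where
  "pullback_coeff \<phi> \<eta> x =
     \<eta> (\<phi> x) (frechet_derivative \<phi> (at x) (axis 1 1))
             (frechet_derivative \<phi> (at x) (axis 2 1))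
             (frechet_derivative \<phi> (at x) (axis 3 1))"

definition subordinate_partition ::
  "'a::real_normed_vector set \<Rightarrow> 'a orientation \<Rightarrow> nat \<Rightarrow> (nat \<Rightarrow> (real^3) set) \<Rightarrow>
     (nat \<Rightarrow> real^3 \<Rightarrow> 'a) \<Rightarrow> (nat \<Rightarrow> 'a \<Rightarrow> real) \<Rightarrow> bool" where
  "subordinate_partition M Or n V \<phi> \<rho> \<longleftrightarrow>
     (\<forall>i<n. oriented_param M Or (V i) (\<phi> i) \<and> continuous_on M (\<rho> i) \<and> (\<forall>p\<in>M. 0 \<le> \<rho> i p) \<and>
            closure {p\<in>M. \<rho> i p \<noteq> 0} \<subseteq> \<phi> i ` V i) \<and>
     (\<forall>p\<in>M. (\<Sum>i<n. \<rho> i p) = 1)"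

text \<open>
  The integral over a compact oriented \<open>M\<close>, independent of the atlas and of the partition of unity.
  For integration it suffices that the partition of unity is continuous.
\<close>

definition form_integral :: "'a::real_normed_vector set \<Rightarrow> 'a orientation \<Rightarrow> 'a form3 \<Rightarrow> complex" where
  "form_integral M Or \<eta> =
     (THE I. \<exists>n V \<phi> \<rho>. subordinate_partition M Or n V \<phi> \<rho> \<and>
        I = (\<Sum>i<n. integral (V i) (\<lambda>x. \<rho> i (\<phi> i x) *\<^sub>R pullback_coeff (\<phi> i) \<eta> x)))"

subsection \<open>The Bott invariant\<close>

definition bott_invariant :: "'a::real_normed_vector set \<Rightarrow> 'a orientation \<Rightarrow> 'a form1 \<Rightarrow> complex" where
  "bott_invariant M Or \<omega> =
     (THE c. formally_integrable M \<omega> \<and>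
        (\<exists>\<alpha>. smooth_form M \<alpha> \<and>
             (\<forall>p\<in>M. \<forall>u\<in>tangent_space M p. \<forall>v\<in>tangent_space M p.
                ext_deriv \<omega> p u v = wedge11 \<alpha> \<omega> p u v) \<and>
             c = form_integral M Or (wedge12 \<alpha> (ext_deriv \<alpha>))))"

subsection \<open>The 3-sphere and the forms \<open>\<omega>\<^sup>a\<close>\<close>

type_synonym C2 = "complex \<times> complex"

abbreviation S3 :: "C2 set" where
  "S3 \<equiv> sphere 0 1"

definition C2_coords :: "C2 \<Rightarrow> real^4" where
  "C2_coords z = vector [Re (fst z), Im (fst z), Re (snd z), Im (snd z)]"

text \<open>Boundary orientation of the unit ball: the outward normal at \<open>p\<close> is \<open>p\<close> and comes first.\<close>

definition S3_orientation :: "C2 orientation" where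
  "S3_orientation p u v w =
     det (vector [C2_coords p, C2_coords u, C2_coords v, C2_coords w] :: real^4^4)"

definition param_set :: "complex set" where
  "param_set = (UNIV - \<real>) \<union> complex_of_real ` {0<..<1}"

text \<open>Here \<open>dz\<^sub>1 = fst\<close> and \<open>dz\<^sub>2 = snd\<close> as linear functionals.\<close>

definition omega :: "complex \<Rightarrow> C2 form1" where
  "omega a z = Blinfun (\<lambda>v. a * fst z * snd v - (1 - a) * snd z * fst v)"

lemma omega_apply: "blinfun_apply (omega a z) v = a * fst z * snd v - (1 - a) * snd z * fst v"
  unfolding omega_def
  by (subst bounded_linear_Blinfun_apply)
     (auto intro!: bounded_linear_intros bounded_linear_const_mult)

end

theory Submission
  imports Defs
begin

text \<open>
  Why the value is \<open>-4\<pi>\<^sup>2 / (a(1 - a))\<close>. On \<open>S\<^sup>3\<close> one has \<open>d\<omega> = dz\<^sub>1 \<and> dz\<^sub>2\<close> and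
  \<open>cnj z\<^sub>1 z\<^sub>1 + cnj z\<^sub>2 z\<^sub>2 = 1\<close>, so that \<open>\<alpha>\<^sub>0 = cnj z\<^sub>1 dz\<^sub>1 / a + cnj z\<^sub>2 dz\<^sub>2 / (1 - a)\<close>
  satisfies \<open>d\<omega> = \<alpha>\<^sub>0 \<and> \<omega>\<close> there. A polynomial computation gives
  \<open>\<alpha>\<^sub>0 \<and> d\<alpha>\<^sub>0 = -2 / (a(1 - a)) vol\<close> on the sphere, and the volume of \<open>S\<^sup>3\<close> is \<open>2\<pi>\<^sup>2\<close>.
  Since the integral and the invariant are defined by definite descriptions, the work lies in
  showing that neither the atlas nor the choice of \<open>\<alpha>\<close> matters.

  Independence of the atlas: a 3-form on \<open>S\<^sup>3\<close> is \<open>g vol\<close> for a function \<open>g\<close>. Extending a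
  chart \<open>\<phi>\<close> radially to \<open>(r, x) \<mapsto> r \<phi>(x)\<close> turns its Jacobian into \<open>r\<^sup>3\<close> times the oriented
  volume of the chart. Change of variables in \<open>\<real>\<^sup>4\<close> and \<open>\<integral> r\<^sup>3 dr = 1/4\<close> then
  show that each summand \<open>\<integral> \<rho> g vol\<close> is four times the integral of the radial extension of
  \<open>\<rho> g\<close> over the unit ball (\<open>oriented_param_integral\<close>). Adding up a partition of unity gives
  \<open>form_integral_S3\<close>; no transition maps occur. Two antipodal stereographic charts provide a
  partition of unity to start with (\<open>ex_subordinate_partition\<close>).

  Independence of \<open>\<alpha>\<close>: the unit quaternions give the global frame \<open>J1 p, J2 p, J3 p\<close> of
  \<open>T\<^sub>p S\<^sup>3\<close>. With \<open>h = \<omega>(J2 p) = a \<bar>z\<^sub>1\<bar>\<^sup>2 + (1 - a) \<bar>z\<^sub>2\<bar>\<^sup>2\<close>, which has no zero on \<open>S\<^sup>3\<close> exactly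
  because of the range of \<open>a\<close>, the condition \<open>d\<omega> = \<alpha> \<and> \<omega>\<close> determines all of \<open>\<alpha>\<close> from
  \<open>F = \<alpha>(J2 p)\<close>, and a computation in the frame (\<open>bott_density_formula\<close>) yields
  \<open>\<alpha> \<and> d\<alpha> = (-2 / h\<^sup>2 - (J2 + \<i> J3)(F / h)) vol\<close>.
  The last term integrates to zero because the flow of each \<open>J\<close> consists of rotations
  (\<open>sphere_integral_derivative\<close>). Hence the integral is that of \<open>-2 / h\<^sup>2\<close> for every admissible
  \<open>\<alpha>\<close>, in particular for \<open>\<alpha>\<^sub>0\<close>.
\<close>

section \<open>Calculus of k times differentiable maps\<close>

lemma Ck_on_cong:
  assumes "open U" "\<And>x. x \<in> U \<Longrightarrow> f x = g x" "Ck_on k U f"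
  shows "Ck_on k U g"
  using assms(2,3)
proof (induction k arbitrary: f g)
  case 0
  then show ?case using continuous_on_cong[of U U f g] by simp
next
  case (Suc k)
  have diff: "f differentiable (at x)" if "x \<in> U" for x
    using Suc.prems(2) that assms(1) by (simp add: differentiable_on_eq_differentiable_at)
  have eq: "frechet_derivative f (at x) = frechet_derivative g (at x)" if "x \<in> U" for x
    using frechet_derivative_transform_within_open[OF diff[OF that] assms(1) that Suc.prems(1)] .
  show ?case
    unfolding Ck_on.simps
  proof (intro conjI allI)
    show "g differentiable_on U"
      unfolding differentiable_on_eq_differentiable_at[OF assms(1)]
    proof
      fix x assume x: "x \<in> U"
      obtain D where "(f has_derivative D) (at x)"
        using diff[OF x] unfolding differentiable_def by blast
      then have "(g has_derivative D) (at x)"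
        by (rule has_derivative_transform_within_open[OF _ assms(1) x Suc.prems(1)])
      then show "g differentiable at x"
        by (rule differentiableI)
    qed
    fix v
    show "Ck_on k U (\<lambda>x. frechet_derivative g (at x) v)"
      by (rule Suc.IH[of "\<lambda>x. frechet_derivative f (at x) v"]) (use Suc.prems(2) in \<open>simp_all add: eq\<close>)
  qed
qed

text \<open>
  Replaces the derivative chosen by \<open>frechet_derivative\<close> by an explicit one, so that the closure
  properties below follow by induction on \<open>k\<close> from the usual rules of differentiation.
\<close>

lemma Ck_on_SucI:
  assumes "open U"
    and "\<And>x. x \<in> U \<Longrightarrow> (f has_derivative f' x) (at x)"
    and "\<And>v. Ck_on k U (\<lambda>x. f' x v)"
  shows "Ck_on (Suc k) U f"
proof -
  have eq: "frechet_derivative f (at x) = f' x" if "x \<in> U" for x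
    using frechet_derivative_at[OF assms(2)[OF that]] by simp
  show ?thesis
    unfolding Ck_on.simps
  proof (intro conjI allI)
    show "f differentiable_on U"
      using assms(2) by (intro differentiable_at_imp_differentiable_on) (auto intro: differentiableI)
    fix v
    show "Ck_on k U (\<lambda>x. frechet_derivative f (at x) v)"
      by (rule Ck_on_cong[OF assms(1) _ assms(3)[of v]]) (simp add: eq)
  qed
qed

lemma Ck_on_Suc_has_derivative:
  assumes "open U" "Ck_on (Suc k) U f" "x \<in> U"
  shows "(f has_derivative frechet_derivative f (at x)) (at x)"
  using assms by (simp add: differentiable_on_eq_differentiable_at flip: frechet_derivative_works)

lemma Ck_on_imp_continuous_on: "Ck_on k U f \<Longrightarrow> continuous_on U f"
  by (cases k) (auto intro: differentiable_imp_continuous_on)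

lemma Ck_on_Suc_imp:
  "Ck_on (Suc k) U f \<Longrightarrow> Ck_on k U f"
proof (induction k arbitrary: f)
  case 0
  then show ?case by (auto intro: differentiable_imp_continuous_on)
next
  case (Suc k)
  from Suc.prems have "f differentiable_on U" and "\<And>v. Ck_on (Suc k) U (\<lambda>x. frechet_derivative f (at x) v)"
    unfolding Ck_on.simps(2)[of "Suc k"] by blast+
  with Suc.IH have "f differentiable_on U \<and> (\<forall>v. Ck_on k U (\<lambda>x. frechet_derivative f (at x) v))"
    by blast
  then show ?case
    by (subst Ck_on.simps(2))
qed

lemma Ck_on_subset:
  assumes "open V" "V \<subseteq> U" "Ck_on k U f"
  shows "Ck_on k V f"
  using assms(3)
proof (induction k arbitrary: f)
  case 0
  then show ?case using assms(2) by (auto intro: continuous_on_subset)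
next
  case (Suc k)
  then show ?case using assms(2) by (auto intro: differentiable_on_subset)
qed

lemma Ck_on_const: "open U \<Longrightarrow> Ck_on k U (\<lambda>x. c)"
proof (induction k arbitrary: c)
  case (Suc k)
  show ?case by (rule Ck_on_SucI[where f'="\<lambda>x v. 0"]) (use Suc in auto)
qed simp

lemma Ck_on_bounded_linear:
  assumes "open U" "bounded_linear L"
  shows "Ck_on k U L"
proof (cases k)
  case 0
  then show ?thesis using assms(2) linear_continuous_on by simp
next
  case (Suc m)
  show ?thesis unfolding Suc
    by (rule Ck_on_SucI[where f'="\<lambda>x. L"])
       (auto intro: assms Ck_on_const bounded_linear_imp_has_derivative)
qed

lemma Ck_on_linear:
  fixes L :: "'a::euclidean_space \<Rightarrow> 'b::real_normed_vector"
  assumes "open U" "linear L"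
  shows "Ck_on k U L"
  using assms Ck_on_bounded_linear linear_conv_bounded_linear by blast

lemma Ck_on_add:
  assumes "open U" "Ck_on k U f" "Ck_on k U g"
  shows "Ck_on k U (\<lambda>x. f x + g x)"
  using assms(2,3)
proof (induction k arbitrary: f g)
  case 0
  then show ?case by (auto intro: continuous_intros)
next
  case (Suc k)
  show ?case
    by (rule Ck_on_SucI[where f'="\<lambda>x v. frechet_derivative f (at x) v + frechet_derivative g (at x) v"])
       (use Suc.prems in \<open>intro assms Suc.IH has_derivative_add Ck_on_Suc_has_derivative[OF assms(1)]; auto\<close>)+
qed

lemma Ck_on_prod:
  assumes "bounded_bilinear B" "open U" "Ck_on k U f" "Ck_on k U g"
  shows "Ck_on k U (\<lambda>x. B (f x) (g x))"
  using assms(3,4)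
proof (induction k arbitrary: f g)
  case 0
  then show ?case using bounded_bilinear.continuous_on[OF assms(1)] by auto
next
  case (Suc k)
  show ?case
  proof (rule Ck_on_SucI[where f'="\<lambda>x v. B (f x) (frechet_derivative g (at x) v)
             + B (frechet_derivative f (at x) v) (g x)"])
    show "((\<lambda>x. B (f x) (g x)) has_derivative (\<lambda>v. B (f x) (frechet_derivative g (at x) v)
             + B (frechet_derivative f (at x) v) (g x))) (at x)" if "x \<in> U" for x
      using Suc.prems that
      by (intro bounded_bilinear.FDERIV[OF assms(1)] Ck_on_Suc_has_derivative[OF assms(2)]) auto
    show "Ck_on k U (\<lambda>x. B (f x) (frechet_derivative g (at x) v)
             + B (frechet_derivative f (at x) v) (g x))" for v
      using Suc.prems Suc.prems[THEN Ck_on_Suc_imp] by (intro Ck_on_add assms Suc.IH) auto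
  qed (rule assms)
qed

lemmas Ck_on_mult = Ck_on_prod[OF bounded_bilinear_mult]
lemmas Ck_on_scaleR = Ck_on_prod[OF bounded_bilinear_scaleR]
lemmas Ck_on_inner = Ck_on_prod[OF bounded_bilinear_inner]
lemmas Ck_on_blinfun_apply = Ck_on_prod[OF bounded_bilinear_blinfun_apply]

lemma Ck_on_inverse:
  fixes f :: "'a::real_normed_vector \<Rightarrow> 'b::real_normed_div_algebra"
  assumes "open U" "\<And>x. x \<in> U \<Longrightarrow> f x \<noteq> 0" "Ck_on k U f"
  shows "Ck_on k U (\<lambda>x. inverse (f x))"
  using assms(3)
proof (induction k)
  case 0
  then show ?case using assms(2) by (auto intro: continuous_intros)
next
  case (Suc k)
  show ?case
  proof (rule Ck_on_SucI[where f'="\<lambda>x v. (-1) * (inverse (f x) * frechet_derivative f (at x) v * inverse (f x))"])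
    show "((\<lambda>x. inverse (f x)) has_derivative
        (\<lambda>v. (-1) * (inverse (f x) * frechet_derivative f (at x) v * inverse (f x)))) (at x)"
      if "x \<in> U" for x
      using Deriv.has_derivative_inverse[OF assms(2)[OF that] Ck_on_Suc_has_derivative[OF assms(1) Suc.prems that]]
      by simp
    show "Ck_on k U (\<lambda>x. (-1) * (inverse (f x) * frechet_derivative f (at x) v * inverse (f x)))" for v
      using Suc Ck_on_Suc_imp[OF Suc.prems] by (intro Ck_on_mult Ck_on_const assms) auto
  qed (rule assms)
qed

text \<open>
  The definition of \<open>Ck_on\<close> only speaks about derivatives in constant directions; expansion in a
  basis gives continuity along a continuous vector field.
\<close>

lemma continuous_on_frechet_derivative:
  fixes f :: "'a::euclidean_space \<Rightarrow> 'b::real_normed_vector"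
  assumes "open U" "Ck_on (Suc 0) U f" "continuous_on U J"
  shows "continuous_on U (\<lambda>x. frechet_derivative f (at x) (J x))"
proof -
  have "frechet_derivative f (at x) (J x) =
      (\<Sum>b\<in>Basis. (J x \<bullet> b) *\<^sub>R frechet_derivative f (at x) b)" if "x \<in> U" for x
  proof -
    have "linear (frechet_derivative f (at x))"
      using Ck_on_Suc_has_derivative[OF assms(1,2) that] has_derivative_linear by blast
    then show ?thesis
      by (subst (1) euclidean_representation[of "J x", symmetric]) (simp add: linear_sum linear_scale)
  qed
  moreover have "continuous_on U (\<lambda>x. \<Sum>b\<in>Basis. (J x \<bullet> b) *\<^sub>R frechet_derivative f (at x) b)"
    using assms(2,3) by (intro continuous_intros) auto
  ultimately show ?thesis by (simp cong: continuous_on_cong)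
qed

section \<open>The quaternionic frame of the 3-sphere\<close>

text \<open>
  Multiplication by the unit quaternions \<open>i, j, k\<close>; the vectors \<open>J1 p, J2 p, J3 p\<close> form a
  positively oriented orthonormal basis of the tangent space of \<open>S3\<close> at \<open>p\<close>.
\<close>

definition J1 :: "C2 \<Rightarrow> C2" where "J1 p = (\<i> * fst p, \<i> * snd p)"
definition J2 :: "C2 \<Rightarrow> C2" where "J2 p = (- cnj (snd p), cnj (fst p))"
definition J3 :: "C2 \<Rightarrow> C2" where "J3 p = (- \<i> * cnj (snd p), \<i> * cnj (fst p))"

definition orthogonal_complex_structure :: "('a::real_inner \<Rightarrow> 'a) \<Rightarrow> bool" where
  "orthogonal_complex_structure J \<longleftrightarrow> orthogonal_transformation J \<and> (\<forall>p. J (J p) = - p)"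

lemma complex_structures:
  "orthogonal_complex_structure J1" "orthogonal_complex_structure J2"
  "orthogonal_complex_structure J3"
  unfolding orthogonal_complex_structure_def orthogonal_transformation_def linear_iff
  by (auto simp: J1_def J2_def J3_def prod_eq_iff complex_eq_iff inner_prod_def inner_complex_def algebra_simps)

lemma quaternion_relations:
  "J1 (J2 p) = J3 p" "J2 (J1 p) = - J3 p" "J2 (J3 p) = J1 p" "J3 (J2 p) = - J1 p"
  "J3 (J1 p) = J2 p" "J1 (J3 p) = - J2 p"
  by (auto simp: J1_def J2_def J3_def prod_eq_iff complex_eq_iff)

context
  fixes J :: "'a::real_inner \<Rightarrow> 'a"
  assumes J: "orthogonal_complex_structure J"
begin

lemma complex_structure_linear: "linear J"
  using J by (simp add: orthogonal_complex_structure_def orthogonal_transformation_def)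

lemma complex_structure_inner: "J u \<bullet> J v = u \<bullet> v"
  using J by (simp add: orthogonal_complex_structure_def orthogonal_transformation_def)

lemma complex_structure_square: "J (J p) = - p"
  using J by (simp add: orthogonal_complex_structure_def)

end

text \<open>
  The one-parameter group \<open>exp (t J)\<close>, which has this closed form because \<open>J\<^sup>2 = -1\<close>.
\<close>

definition rot :: "('a::real_inner \<Rightarrow> 'a) \<Rightarrow> real \<Rightarrow> 'a \<Rightarrow> 'a" where
  "rot J t p = cos t *\<^sub>R p + sin t *\<^sub>R J p"

context
  fixes J :: "'a::real_inner \<Rightarrow> 'a"
  assumes J: "orthogonal_complex_structure J"
begin

lemma rot_0: "rot J 0 p = p"
  by (simp add: rot_def)

lemma orthogonal_rot: "orthogonal_transformation (rot J t)"
  unfolding orthogonal_transformation_def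
proof (intro conjI allI)
  note lin = complex_structure_linear[OF J]
  show "linear (rot J t)"
    by (rule linearI) (simp_all add: rot_def linear_add[OF lin] linear_scale[OF lin] algebra_simps)
  fix v w
  have "J v \<bullet> w = - (v \<bullet> J w)"
    using complex_structure_inner[OF J, of v "J w"] by (simp add: complex_structure_square[OF J])
  then have "(c *\<^sub>R v + s *\<^sub>R J v) \<bullet> (c *\<^sub>R w + s *\<^sub>R J w) = (c\<^sup>2 + s\<^sup>2) * (v \<bullet> w)" for c s
    by (simp add: inner_add power2_eq_square complex_structure_inner[OF J] algebra_simps)
  then show "rot J t v \<bullet> rot J t w = v \<bullet> w"
    by (simp add: rot_def)
qed

lemma norm_rot: "norm (rot J t p) = norm p"
  using orthogonal_transformation_norm[OF orthogonal_rot] .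

lemma rot_has_vector_derivative:
  "((\<lambda>t. rot J t p) has_vector_derivative J (rot J t p)) (at t within X)"
proof -
  note lin = complex_structure_linear[OF J]
  have "J (rot J t p) = - sin t *\<^sub>R p + cos t *\<^sub>R J p"
    by (simp add: rot_def linear_add[OF lin] linear_scale[OF lin] complex_structure_square[OF J])
  moreover have "((\<lambda>t. cos t *\<^sub>R p + sin t *\<^sub>R J p) has_vector_derivative
      (- sin t *\<^sub>R p + cos t *\<^sub>R J p)) (at t within X)"
    by (auto intro!: derivative_eq_intros simp: has_vector_derivative_def algebra_simps)
  ultimately show ?thesis
    unfolding rot_def by simp
qed

lemma complex_structure_in_tangent_space:
  assumes "p \<in> sphere 0 1"
  shows "J p \<in> tangent_space (sphere 0 1) p"
  unfolding tangent_space_def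
proof (intro CollectI exI conjI)
  show "range (\<lambda>t. rot J t p) \<subseteq> sphere 0 1"
    using assms by (auto simp: norm_rot)
  show "rot J 0 p = p" by (rule rot_0)
  show "((\<lambda>t. rot J t p) has_vector_derivative J p) (at 0)"
    using rot_has_vector_derivative[of p 0 UNIV] by (simp add: rot_0)
qed

lemma has_derivative_along_rot:
  assumes "(f has_derivative f') (at (rot J t p))"
  shows "((\<lambda>t. f (rot J t p)) has_vector_derivative f' (J (rot J t p))) (at t within X)"
  using vector_derivative_diff_chain_within[OF rot_has_vector_derivative has_derivative_at_withinI[OF assms]]
  by (simp add: o_def)

text \<open>
  The flow line through \<open>p\<close> stays in the sphere. This allows identities that hold only on the
  sphere to be differentiated along the frame.
\<close>

lemma derivative_cong_on_sphere:
  assumes "p \<in> sphere 0 1" "\<And>q. q \<in> sphere 0 1 \<Longrightarrow> f q = g q"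
    and "(f has_derivative f') (at p)" "(g has_derivative g') (at p)"
  shows "f' (J p) = g' (J p)"
proof -
  have "f (rot J t p) = g (rot J t p)" for t
    using assms(1,2) by (simp add: norm_rot)
  moreover have "((\<lambda>t. f (rot J t p)) has_vector_derivative f' (J p)) (at 0)"
    "((\<lambda>t. g (rot J t p)) has_vector_derivative g' (J p)) (at 0)"
    using has_derivative_along_rot[of _ _ 0 p UNIV] assms(3,4) by (auto simp: rot_0)
  ultimately show ?thesis
    using vector_derivative_unique_at by auto
qed

end

lemma frame_expansion:
  assumes "norm p = 1" "p \<bullet> u = 0"
  shows "u = (u \<bullet> J1 p) *\<^sub>R J1 p + (u \<bullet> J2 p) *\<^sub>R J2 p + (u \<bullet> J3 p) *\<^sub>R J3 p"
proof -
  have "(p \<bullet> p) *\<^sub>R u = (p \<bullet> u) *\<^sub>R p + (u \<bullet> J1 p) *\<^sub>R J1 p + (u \<bullet> J2 p) *\<^sub>R J2 p + (u \<bullet> J3 p) *\<^sub>R J3 p"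
    by (auto simp: J1_def J2_def J3_def prod_eq_iff complex_eq_iff inner_prod_def inner_complex_def algebra_simps)
  then show ?thesis using assms by (simp add: norm_eq_1)
qed

text \<open>
  The volume spanned by three tangent vectors at \<open>p\<close>, computed from their coordinates in the frame.
\<close>

definition frame_det :: "C2 \<Rightarrow> C2 \<Rightarrow> C2 \<Rightarrow> C2 \<Rightarrow> real" where
  "frame_det p u v w = det (vector [
      vector [u \<bullet> J1 p, u \<bullet> J2 p, u \<bullet> J3 p],
      vector [v \<bullet> J1 p, v \<bullet> J2 p, v \<bullet> J3 p],
      vector [w \<bullet> J1 p, w \<bullet> J2 p, w \<bullet> J3 p]] :: real^3^3)"

text \<open>
  Alternating 3-forms on a 3-dimensional space form a line. Here \<open>B\<close> stands for the exterior
  derivative of the form with value \<open>L\<close>.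
\<close>

lemma alternating_frame:
  fixes L :: "C2 \<Rightarrow> complex" and B :: "C2 \<Rightarrow> C2 \<Rightarrow> complex"
  assumes L: "linear L" and B: "\<And>x. linear (B x)" and anti: "\<And>x y. B y x = - B x y"
    and p: "norm p = 1" and uvw: "p \<bullet> u = 0" "p \<bullet> v = 0" "p \<bullet> w = 0"
  shows "L u * B v w - L v * B u w + L w * B u v = of_real (frame_det p u v w) *
    (L (J1 p) * B (J2 p) (J3 p) - L (J2 p) * B (J1 p) (J3 p) + L (J3 p) * B (J1 p) (J2 p))"
proof -
  have Br: "B x (y + z) = B x y + B x z" "B x (c *\<^sub>R z) = of_real c * B x z" for x y z c
    using linear_add[OF B] linear_scale[OF B] by (auto simp: scaleR_conv_of_real)
  have Bl: "B (x + y) z = B x z + B y z" "B (c *\<^sub>R x) z = of_real c * B x z" for x y z c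
    using Br[of z] anti[of x z] anti[of y z] anti[of "x + y" z] anti[of "c *\<^sub>R x" z] by simp_all
  have B0: "B x x = 0" for x using anti[of x x] by simp
  have Ll: "L (x + y) = L x + L y" "L (c *\<^sub>R x) = of_real c * L x" for x y c
    using linear_add[OF L] linear_scale[OF L] by (auto simp: scaleR_conv_of_real)
  have *: "L u * B v w - L v * B u w + L w * B u v = of_real
      (u1 * v2 * w3 + u2 * v3 * w1 + u3 * v1 * w2 - u1 * v3 * w2 - u2 * v1 * w3 - u3 * v2 * w1) *
    (L (J1 p) * B (J2 p) (J3 p) - L (J2 p) * B (J1 p) (J3 p) + L (J3 p) * B (J1 p) (J2 p))"
    if "u = u1 *\<^sub>R J1 p + u2 *\<^sub>R J2 p + u3 *\<^sub>R J3 p"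
       "v = v1 *\<^sub>R J1 p + v2 *\<^sub>R J2 p + v3 *\<^sub>R J3 p"
       "w = w1 *\<^sub>R J1 p + w2 *\<^sub>R J2 p + w3 *\<^sub>R J3 p" for u1 u2 u3 v1 v2 v3 w1 w2 w3
    unfolding that Bl Br Ll B0 anti[of "J1 p" "J2 p"] anti[of "J1 p" "J3 p"] anti[of "J2 p" "J3 p"]
    by (simp add: algebra_simps)
  show ?thesis
    using *[OF frame_expansion[OF p uvw(1)] frame_expansion[OF p uvw(2)] frame_expansion[OF p uvw(3)]]
    by (simp add: frame_det_def det_3)
qed

lemma det_4:
  "det (A::'a::comm_ring_1^4^4) =
     A$1$1 * (A$2$2*A$3$3*A$4$4 + A$2$3*A$3$4*A$4$2 + A$2$4*A$3$2*A$4$3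
            - A$2$2*A$3$4*A$4$3 - A$2$3*A$3$2*A$4$4 - A$2$4*A$3$3*A$4$2)
   - A$1$2 * (A$2$1*A$3$3*A$4$4 + A$2$3*A$3$4*A$4$1 + A$2$4*A$3$1*A$4$3
            - A$2$1*A$3$4*A$4$3 - A$2$3*A$3$1*A$4$4 - A$2$4*A$3$3*A$4$1)
   + A$1$3 * (A$2$1*A$3$2*A$4$4 + A$2$2*A$3$4*A$4$1 + A$2$4*A$3$1*A$4$2
            - A$2$1*A$3$4*A$4$2 - A$2$2*A$3$1*A$4$4 - A$2$4*A$3$2*A$4$1)
   - A$1$4 * (A$2$1*A$3$2*A$4$3 + A$2$2*A$3$3*A$4$1 + A$2$3*A$3$1*A$4$2
            - A$2$1*A$3$3*A$4$2 - A$2$2*A$3$1*A$4$3 - A$2$3*A$3$2*A$4$1)"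
proof -
  have f1: "finite {2::4, 3, 4}" "1 \<notin> {2::4, 3, 4}"
   and f2: "finite {3::4, 4}" "2 \<notin> {3::4, 4}"
   and f3: "finite {4::4}" "3 \<notin> {4::4}"
    by auto
  show ?thesis
    unfolding det_def UNIV_4
    unfolding sum_over_permutations_insert[OF f1]
    unfolding sum_over_permutations_insert[OF f2]
    unfolding sum_over_permutations_insert[OF f3]
    unfolding permutes_sing
    by (simp add: sign_swap_id permutation_swap_id sign_compose permutation_compose sign_id swap_id_eq)
       (simp add: algebra_simps)
qed

lemma vector_4 [simp]:
  "(vector [w, x, y, z] :: 'a::zero^4) $ 1 = w" "(vector [w, x, y, z] :: 'a::zero^4) $ 2 = x"
  "(vector [w, x, y, z] :: 'a::zero^4) $ 3 = y" "(vector [w, x, y, z] :: 'a::zero^4) $ 4 = z"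
  by (simp_all add: vector_def)

definition C2_of_R4 :: "real^4 \<Rightarrow> C2" where
  "C2_of_R4 y = (Complex (y$1) (y$2), Complex (y$3) (y$4))"

lemma C2_coords_inverse [simp]: "C2_of_R4 (C2_coords p) = p"
  by (simp add: C2_of_R4_def C2_coords_def)

lemma C2_of_R4_inverse [simp]: "C2_coords (C2_of_R4 y) = y"
  by (simp add: C2_of_R4_def C2_coords_def vec_eq_iff forall_4)

lemma C2_coords_inner: "C2_coords p \<bullet> C2_coords q = p \<bullet> q"
  by (simp add: C2_coords_def inner_vec_def sum_4 inner_prod_def inner_complex_def)

lemma linear_C2_coords: "linear C2_coords"
  by (rule linearI) (simp_all add: C2_coords_def vec_eq_iff forall_4)

lemma linear_C2_of_R4: "linear C2_of_R4"
  by (rule linearI) (simp_all add: C2_of_R4_def prod_eq_iff complex_eq_iff)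

lemma norm_C2_coords [simp]: "norm (C2_coords p) = norm p"
  by (simp add: norm_eq_sqrt_inner C2_coords_inner)

lemma norm_C2_of_R4 [simp]: "norm (C2_of_R4 y) = norm y"
  by (metis C2_of_R4_inverse norm_C2_coords)

text \<open>
  In the coordinates of the orthonormal basis \<open>p, J1 p, J2 p, J3 p\<close>, whose determinant is
  \<open>\<bar>p\<bar>\<^sup>4 = 1\<close>, the matrix defining the orientation becomes block diagonal.
\<close>

lemma S3_orientation_frame:
  assumes p: "norm p = 1" and uvw: "p \<bullet> u = 0" "p \<bullet> v = 0" "p \<bullet> w = 0"
  shows "S3_orientation p u v w = frame_det p u v w"
proof -
  have pp: "(Re (fst p))\<^sup>2 + (Im (fst p))\<^sup>2 + (Re (snd p))\<^sup>2 + (Im (snd p))\<^sup>2 = 1"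
    using p by (simp add: norm_eq_1 inner_prod_def inner_complex_def power2_eq_square)
  define M :: "real^4^4" where "M = vector [C2_coords p, C2_coords (J1 p), C2_coords (J2 p), C2_coords (J3 p)]"
  have M: "det M = 1"
  proof -
    have "det M = ((Re (fst p))\<^sup>2 + (Im (fst p))\<^sup>2 + (Re (snd p))\<^sup>2 + (Im (snd p))\<^sup>2)\<^sup>2"
      unfolding M_def det_4 by (simp add: C2_coords_def J1_def J2_def J3_def power2_eq_square algebra_simps)
    then show ?thesis by (simp add: pp)
  qed
  define K :: "real^4^4" where "K = vector [vector [1,0,0,0],
      vector [0, u \<bullet> J1 p, u \<bullet> J2 p, u \<bullet> J3 p],
      vector [0, v \<bullet> J1 p, v \<bullet> J2 p, v \<bullet> J3 p],
      vector [0, w \<bullet> J1 p, w \<bullet> J2 p, w \<bullet> J3 p]]"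
  have row: "C2_coords x $ j = (x \<bullet> J1 p) * C2_coords (J1 p) $ j + (x \<bullet> J2 p) * C2_coords (J2 p) $ j
      + (x \<bullet> J3 p) * C2_coords (J3 p) $ j" if "p \<bullet> x = 0" for x j
    using arg_cong[OF frame_expansion[OF p that], of "\<lambda>y. C2_coords y $ j"]
    by (simp add: linear_add[OF linear_C2_coords] linear_scale[OF linear_C2_coords])
  have "vector [C2_coords p, C2_coords u, C2_coords v, C2_coords w] = K ** M"
    by (simp add: vec_eq_iff forall_4 matrix_matrix_mult_def sum_4 K_def M_def row[OF uvw(1)] row[OF uvw(2)] row[OF uvw(3)])
  moreover have "det K = frame_det p u v w"
    unfolding det_4 frame_det_def det_3 K_def by simp
  ultimately show ?thesis
    unfolding S3_orientation_def using M by (simp add: det_mul)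
qed

section \<open>Change of variables and Fubini in four dimensions\<close>

text \<open>
  The real-vector-valued change of variables theorem, transported along \<open>\<complex> = \<real>\<^sup>2\<close>.
\<close>

lemma change_of_variables_complex:
  fixes f :: "real^'m::{finite,wellorder} \<Rightarrow> complex" and g :: "real^'m::_ \<Rightarrow> real^'m::_"
  assumes S: "S \<in> sets lebesgue"
    and der: "\<And>x. x \<in> S \<Longrightarrow> (g has_derivative g' x) (at x within S)"
    and inj: "inj_on g S"
    and int: "(\<lambda>x. \<bar>det (matrix (g' x))\<bar> *\<^sub>R f (g x)) absolutely_integrable_on S"
  shows "f absolutely_integrable_on g ` S"
    and "integral (g ` S) f = integral S (\<lambda>x. \<bar>det (matrix (g' x))\<bar> *\<^sub>R f (g x))"
proof -
  define L :: "complex \<Rightarrow> real^2" where "L c = vector [Re c, Im c]" for c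
  define L' :: "real^2 \<Rightarrow> complex" where "L' v = Complex (v$1) (v$2)" for v
  have linL: "linear L" by (rule linearI) (simp_all add: L_def vec_eq_iff forall_2)
  then have L: "bounded_linear L" by (simp add: linear_conv_bounded_linear)
  have "linear L'" by (rule linearI) (simp_all add: L'_def complex_eq_iff)
  then have L': "bounded_linear L'" by (simp add: linear_conv_bounded_linear)
  have inv: "L' (L c) = c" for c by (simp add: L_def L'_def)
  let ?h = "\<lambda>x. \<bar>det (matrix (g' x))\<bar> *\<^sub>R f (g x)"
  have eq: "(L \<circ> ?h) = (\<lambda>x. \<bar>det (matrix (g' x))\<bar> *\<^sub>R (L \<circ> f) (g x))"
    by (simp add: fun_eq_iff linear_scale[OF linL])
  have "(L \<circ> ?h) absolutely_integrable_on S"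
    by (rule absolutely_integrable_linear[OF int L])
  then have *: "(L \<circ> f) absolutely_integrable_on g ` S"
      "integral (g ` S) (L \<circ> f) = integral S (L \<circ> ?h)"
    using has_absolute_integral_change_of_variables[OF S der inj, of "L \<circ> f" "integral S (L \<circ> ?h)"]
    unfolding eq by auto
  have f: "f = L' \<circ> (L \<circ> f)" by (simp add: fun_eq_iff inv)
  show f_int: "f absolutely_integrable_on g ` S"
    by (subst f) (rule absolutely_integrable_linear[OF *(1) L'])
  have "L (integral (g ` S) f) = L (integral S ?h)"
    using *(2) integral_linear[OF set_lebesgue_integral_eq_integral(1)[OF int] L]
      integral_linear[OF set_lebesgue_integral_eq_integral(1)[OF f_int] L] by simp
  then show "integral (g ` S) f = integral S ?h"
    by (metis inv)
qed

definition tail4 :: "real^4 \<Rightarrow> real^3" where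
  "tail4 y = vector [y$2, y$3, y$4]"

definition cons4 :: "real \<times> (real^3) \<Rightarrow> real^4" where
  "cons4 p = vector [fst p, snd p $ 1, snd p $ 2, snd p $ 3]"

lemma tail4_nth [simp]: "tail4 y $ 1 = y $ 2" "tail4 y $ 2 = y $ 3" "tail4 y $ 3 = y $ 4"
  by (simp_all add: tail4_def)

lemma cons4_nth [simp]: "cons4 (r, x) $ 1 = r" "cons4 (r, x) $ 2 = x $ 1" "cons4 (r, x) $ 3 = x $ 2"
   "cons4 (r, x) $ 4 = x $ 3"
  by (simp_all add: cons4_def)

lemma tail4_cons4 [simp]: "tail4 (cons4 (r, x)) = x"
  by (simp add: vec_eq_iff forall_3)

lemma cons4_tail4 [simp]: "cons4 (y $ 1, tail4 y) = y"
  by (simp add: vec_eq_iff forall_4)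

lemma linear_tail4: "linear tail4"
  by (rule linearI) (simp_all add: vec_eq_iff forall_3)

lemma cons4_cbox: "cons4 ` cbox (a, c) (b, d) = cbox (cons4 (a, c)) (cons4 (b, d))"
proof
  show "cons4 ` cbox (a, c) (b, d) \<subseteq> cbox (cons4 (a, c)) (cons4 (b, d))"
    by (auto simp: cbox_Pair_eq mem_box_cart forall_4 forall_3)
  show "cbox (cons4 (a, c)) (cons4 (b, d)) \<subseteq> cons4 ` cbox (a, c) (b, d)"
  proof
    fix y assume "y \<in> cbox (cons4 (a, c)) (cons4 (b, d))"
    then have "(y $ 1, tail4 y) \<in> cbox (a, c) (b, d)"
      by (auto simp: cbox_Pair_eq mem_box_cart forall_4 forall_3)
    then show "y \<in> cons4 ` cbox (a, c) (b, d)"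
      by (metis cons4_tail4 image_eqI)
  qed
qed

lemma split_cbox: "(\<lambda>y. (y $ 1, tail4 y)) ` cbox u v = cbox (u $ 1, tail4 u) (v $ 1, tail4 v)"
proof -
  have "cbox u v = cons4 ` cbox (u $ 1, tail4 u) (v $ 1, tail4 v)"
    by (simp add: cons4_cbox)
  moreover have "(\<lambda>y. (y $ 1, tail4 y)) \<circ> cons4 = id"
    by (auto simp: fun_eq_iff)
  ultimately show ?thesis
    by (simp add: image_comp)
qed

lemma prod_UNIV_3: "prod f (UNIV::3 set) = f 1 * f 2 * f 3"
  unfolding UNIV_3 by (simp add: ac_simps)

lemma prod_UNIV_4: "prod f (UNIV::4 set) = f 1 * (f 2 * f 3 * f 4)"
  unfolding UNIV_4 by (simp add: ac_simps)

text \<open>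
  The identification of \<open>\<real> \<times> \<real>\<^sup>3\<close> with \<open>\<real>\<^sup>4\<close> maps boxes to boxes of equal content and hence
  preserves integrals.
\<close>

lemma has_integral_cons4:
  fixes f :: "real \<times> (real^3) \<Rightarrow> 'b::real_normed_vector"
  assumes "(f has_integral i) (cbox (a, c) (b, d))"
  shows "((\<lambda>y. f (y $ 1, tail4 y)) has_integral i) (cbox (cons4 (a, c)) (cons4 (b, d)))"
proof -
  have "((\<lambda>y. f (y $ 1, tail4 y)) has_integral (1 / 1) *\<^sub>R i) (cons4 ` cbox (a, c) (b, d))"
  proof (rule has_integral_twiddle[where r=1 and h=cons4 and g="\<lambda>y. (y $ 1, tail4 y)"])
    show "continuous (at x) (\<lambda>y. (y $ 1, tail4 y))" for x
      by (intro continuous_intros linear_continuous_at) 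
         (simp add: linear_tail4 linear_conv_bounded_linear[symmetric])
    show "\<exists>w z. (\<lambda>y. (y $ 1, tail4 y)) ` cbox u v = cbox w z" for u v
      using split_cbox by blast
    show "\<exists>w z. cons4 ` cbox u v = cbox w z" for u v
      by (intro exI) (rule cons4_cbox[of "fst u" "snd u" "fst v" "snd v", unfolded prod.collapse])
    show "measure lborel ((\<lambda>y. (y $ 1, tail4 y)) ` cbox u v) = 1 * measure lborel (cbox u v)" for u v
    proof (cases "cbox u v = {}")
      case False
      then have "cbox (u $ 1, tail4 u) (v $ 1, tail4 v) \<noteq> {}"
        unfolding split_cbox[symmetric] by simp
      then have ne: "cbox (u $ 1) (v $ 1) \<noteq> {}" "cbox (tail4 u) (tail4 v) \<noteq> {}"
        by (auto simp: cbox_Pair_eq)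
      then show ?thesis
        unfolding split_cbox content_Pair content_cbox_cart[OF False] content_cbox_cart[OF ne(2)]
        by (simp add: prod_UNIV_3 prod_UNIV_4 box_ne_empty)
    qed simp
    show "(f has_integral i) (cbox (a, c) (b, d))" by (rule assms)
  qed (auto simp: split_paired_all)
  then show ?thesis by (simp add: cons4_cbox)
qed

lemma integral_cube: "integral {0..1} (\<lambda>r::real. r ^ 3) = 1 / 4"
proof -
  have "((\<lambda>r::real. r ^ 3) has_integral (1 ^ 4 / 4 - 0 ^ 4 / 4)) {0..1}"
    by (rule fundamental_theorem_of_calculus)
       (auto intro!: derivative_eq_intros simp: has_real_derivative_iff_has_vector_derivative[symmetric])
  then show ?thesis by (simp add: integral_unique)
qed

text \<open>
  The integral that arises from the radial extension of a chart: the factor \<open>r\<^sup>3\<close> contributes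
  \<open>1/4\<close>. Compact support makes the integrand continuous on a closed box, where the iterated
  integral is available; the box and \<open>S\<close> differ only where the integrand vanishes and on the two
  hyperplanes \<open>r = 0\<close> and \<open>r = 1\<close>.
\<close>

lemma cone_fubini:
  fixes H :: "real^3 \<Rightarrow> complex"
  assumes cont: "continuous_on UNIV H" and K: "compact K" "\<And>x. x \<notin> K \<Longrightarrow> H x = 0" "K \<subseteq> V"
  defines "S \<equiv> {y. 0 < y $ 1 \<and> y $ 1 < 1 \<and> tail4 y \<in> V}"
  shows "(\<lambda>y. (y $ 1) ^ 3 *\<^sub>R H (tail4 y)) absolutely_integrable_on S"
    and "integral S (\<lambda>y. (y $ 1) ^ 3 *\<^sub>R H (tail4 y)) = (1 / 4) *\<^sub>R integral V H"
proof -
  obtain c d where cd: "K \<subseteq> cbox c d"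
    using compact_imp_bounded[OF K(1)] bounded_subset_cbox_symmetric by metis
  let ?f = "\<lambda>p::real \<times> (real^3). fst p ^ 3 *\<^sub>R H (snd p)"
  let ?F = "\<lambda>y. (y $ 1) ^ 3 *\<^sub>R H (tail4 y)"
  let ?B = "cbox (cons4 (0, c)) (cons4 (1, d))"
  have contf: "continuous_on X ?f" for X
    by (intro continuous_intros continuous_on_compose2[OF cont]) auto
  have "continuous_on UNIV tail4"
    by (intro linear_continuous_on) (simp add: linear_tail4 linear_conv_bounded_linear[symmetric])
  then have contF: "continuous_on X ?F" for X
    by (intro continuous_intros continuous_on_compose2[OF cont]) (auto intro: continuous_on_subset)
  have ae: "negligible ({y \<in> S - ?B. ?F y \<noteq> 0} )" "negligible {y \<in> ?B - S. ?F y \<noteq> 0}"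
  proof -
    have "{y \<in> S - ?B. ?F y \<noteq> 0} = {}"
    proof -
      have "y \<in> ?B" if "y \<in> S" "?F y \<noteq> 0" for y
      proof -
        have "tail4 y \<in> cbox c d" using that K(2) cd by fastforce
        then show ?thesis using that by (auto simp: S_def mem_box_cart forall_4 forall_3)
      qed
      then show ?thesis by auto
    qed
    then show "negligible ({y \<in> S - ?B. ?F y \<noteq> 0} )" by (simp only: negligible_empty)
    have "{y \<in> ?B - S. ?F y \<noteq> 0} \<subseteq> {y. y $ 1 = 0} \<union> {y. y $ 1 = 1}"
    proof clarify
      fix y assume y: "y \<in> ?B" "y \<notin> S" "?F y \<noteq> 0" "y $ 1 \<noteq> 1"
      then have "tail4 y \<in> V" using K by auto
      then show "y $ 1 = 0" using y by (auto simp: S_def mem_box_cart forall_4)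
    qed
    then show "negligible {y \<in> ?B - S. ?F y \<noteq> 0}"
      by (rule negligible_subset[rotated])
         (intro negligible_Un; simp add: cart_eq_inner_axis negligible_standard_hyperplane)
  qed
  have "?F absolutely_integrable_on ?B"
    by (rule absolutely_integrable_continuous[OF contF])
  then show "?F absolutely_integrable_on S"
    using absolutely_integrable_spike_set_eq[OF ae] by blast
  have "integral S ?F = integral ?B ?F"
    by (rule integral_spike_set[OF ae])
  also have "\<dots> = integral (cbox (0, c) (1, d)) ?f"
    using has_integral_cons4[OF integrable_integral[OF integrable_continuous[OF contf]]]
    by (simp add: integral_unique)
  also have "\<dots> = integral (cbox 0 1) (\<lambda>r. integral (cbox c d) (\<lambda>x. r ^ 3 *\<^sub>R H x))"
    by (subst integral_prod_continuous[OF contf]) simp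
  also have "\<dots> = integral {0..1} (\<lambda>r. r ^ 3 *\<^sub>R integral (cbox c d) H)"
    by simp
  also have "\<dots> = (1 / 4) *\<^sub>R integral (cbox c d) H"
  proof -
    have "(\<lambda>r::real. r ^ 3) integrable_on {0..1}"
      by (intro integrable_continuous_interval continuous_intros)
    from integral_linear[OF this bounded_linear_scaleR_left[of "integral (cbox c d) H"]]
    show ?thesis by (simp add: o_def integral_cube)
  qed
  also have "integral (cbox c d) H = integral V H"
  proof (rule integral_spike_set)
    have "{x \<in> cbox c d - V. H x \<noteq> 0} = {}" "{x \<in> V - cbox c d. H x \<noteq> 0} = {}"
      using K cd by auto
    then show "negligible {x \<in> cbox c d - V. H x \<noteq> 0}" "negligible {x \<in> V - cbox c d. H x \<noteq> 0}"
      by (simp_all only: negligible_empty)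
  qed
  finally show "integral S ?F = (1 / 4) *\<^sub>R integral V H" .
qed

section \<open>Integration over the sphere through the ball\<close>

lemma det_cone_matrix:
  fixes q0 q1 q2 q3 :: "real^4" and r :: real
  assumes "L (axis 1 1) = q0" "L (axis 2 1) = r *\<^sub>R q1" "L (axis 3 1) = r *\<^sub>R q2" "L (axis 4 1) = r *\<^sub>R q3"
  shows "det (matrix L :: real^4^4) = r ^ 3 * det (vector [q0, q1, q2, q3] :: real^4^4)"
  by (simp add: det_4 matrix_def assms power3_eq_cube algebra_simps)

text \<open>
  Integration of a radially constant function over the cone on a chart of the unit sphere, by the
  substitution \<open>(r, x) \<mapsto> r q(x)\<close>. Its Jacobian matrix has the columns \<open>q, r \<partial>\<^sub>1q, r \<partial>\<^sub>2q, r \<partial>\<^sub>3q\<close>,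
  which explains \<open>J\<close>; the set \<open>K\<close> carries the support of the function.
\<close>

lemma cone_integral:
  fixes q :: "real^3 \<Rightarrow> real^4" and G :: "real^4 \<Rightarrow> complex"
  assumes V: "open V" and q: "\<And>x. x \<in> V \<Longrightarrow> (q has_derivative q' x) (at x)" and inj: "inj_on q V"
    and norm: "\<And>x. x \<in> V \<Longrightarrow> norm (q x) = 1"
    and J: "\<And>x. x \<in> V \<Longrightarrow>
        J x = det (vector [q x, q' x (axis 1 1), q' x (axis 2 1), q' x (axis 3 1)] :: real^4^4)"
    and pos: "\<And>x. x \<in> V \<Longrightarrow> 0 \<le> J x"
    and hom: "\<And>r y. 0 < r \<Longrightarrow> G (r *\<^sub>R y) = G y"
    and cont: "continuous_on V (\<lambda>x. J x *\<^sub>R G (q x))"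
    and K: "compact K" "K \<subseteq> V" "\<And>x. x \<in> V - K \<Longrightarrow> G (q x) = 0"
  defines "C \<equiv> {r *\<^sub>R q x | r x. 0 < r \<and> r < 1 \<and> x \<in> V}"
  shows "integral C G = (1 / 4) *\<^sub>R integral V (\<lambda>x. J x *\<^sub>R G (q x))"
proof -
  define S where "S = {y. 0 < y $ 1 \<and> y $ 1 < 1 \<and> tail4 y \<in> V}"
  define P where "P y = y $ 1 *\<^sub>R q (tail4 y)" for y :: "real^4"
  define P' where "P' y h = y $ 1 *\<^sub>R q' (tail4 y) (tail4 h) + h $ 1 *\<^sub>R q (tail4 y)" for y h :: "real^4"
  define H where "H x = (if x \<in> V then J x *\<^sub>R G (q x) else 0)" for x
  have bl: "bounded_linear tail4"
    by (simp add: linear_tail4 linear_conv_bounded_linear[symmetric])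
  have "open (tail4 -` V)"
    by (rule continuous_open_vimage[OF V]) (rule linear_continuous_at[OF bl])
  then have "open {y. tail4 y \<in> V}"
    by (simp add: vimage_def)
  then have "open S"
    unfolding S_def by (intro open_Collect_conj open_Collect_less continuous_intros)
  then have S: "S \<in> sets lebesgue" by simp
  have der: "(P has_derivative P' y) (at y within S)" if "y \<in> S" for y
  proof -
    have "((\<lambda>y. q (tail4 y)) has_derivative (\<lambda>h. q' (tail4 y) (tail4 h))) (at y within S)"
      using has_derivative_compose[OF bounded_linear_imp_has_derivative[OF bl] q] that by (auto simp: S_def)
    then show ?thesis
      unfolding P_def P'_def
      by (intro has_derivative_scaleR bounded_linear_imp_has_derivative bounded_linear_vec_nth)
  qed
  have normP: "norm (P y) = y $ 1" if "y \<in> S" for y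
    using that norm by (simp add: P_def S_def)
  have injP: "inj_on P S"
  proof
    fix y z assume yz: "y \<in> S" "z \<in> S" "P y = P z"
    then have 1: "y $ 1 = z $ 1" using normP by metis
    then have "q (tail4 y) = q (tail4 z)" using yz by (auto simp: P_def S_def)
    then have "tail4 y = tail4 z" using yz inj by (auto simp: S_def inj_on_def)
    then show "y = z" using 1 by (metis cons4_tail4)
  qed
  have image: "P ` S = C"
  proof
    show "P ` S \<subseteq> C" by (auto simp: P_def S_def C_def)
    show "C \<subseteq> P ` S"
    proof
      fix z assume "z \<in> C"
      then obtain r x where "z = r *\<^sub>R q x" "0 < r" "r < 1" "x \<in> V" by (auto simp: C_def)
      then have "z = P (cons4 (r, x))" "cons4 (r, x) \<in> S" by (auto simp: P_def S_def)
      then show "z \<in> P ` S" by blast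
    qed
  qed
  have detP: "\<bar>det (matrix (P' y))\<bar> *\<^sub>R G (P y) = (y $ 1) ^ 3 *\<^sub>R H (tail4 y)" if "y \<in> S" for y
  proof -
    have y: "tail4 y \<in> V" "0 < y $ 1" using that by (auto simp: S_def)
    have lin: "linear (q' (tail4 y))" using q[OF y(1)] has_derivative_linear by blast
    have ax: "tail4 (axis 1 1) = 0" "tail4 (axis 2 1) = axis 1 1" "tail4 (axis 3 1) = axis 2 1"
      "tail4 (axis 4 1) = axis 3 1"
      by (simp_all add: vec_eq_iff forall_3 axis_def)
    have "det (matrix (P' y)) = (y $ 1) ^ 3 * J (tail4 y)"
      unfolding J[OF y(1)]
      by (rule det_cone_matrix) (simp_all add: P'_def ax linear_0[OF lin], simp_all add: axis_def)
    moreover have "0 \<le> (y $ 1) ^ 3 * J (tail4 y)" using y pos by simp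
    ultimately show ?thesis using y hom by (simp add: H_def P_def)
  qed
  have contH: "continuous_on UNIV H"
  proof -
    have "continuous_on V H" using cont by (simp add: H_def cong: continuous_on_cong)
    moreover have "continuous_on (- K) H"
    proof -
      have "H x = 0" if "x \<in> - K" for x using that K by (auto simp: H_def)
      then show ?thesis
        using continuous_on_cong[of "- K" "- K" H "\<lambda>_. 0"] by simp
    qed
    ultimately have "continuous_on (V \<union> - K) H"
      using V K compact_imp_closed by (intro continuous_on_open_Un) auto
    moreover have "V \<union> - K = UNIV" using K by auto
    ultimately show ?thesis by simp
  qed
  have H0: "H x = 0" if "x \<notin> K" for x using that K by (auto simp: H_def)
  have fub: "(\<lambda>y. (y $ 1) ^ 3 *\<^sub>R H (tail4 y)) absolutely_integrable_on S"
    "integral S (\<lambda>y. (y $ 1) ^ 3 *\<^sub>R H (tail4 y)) = (1 / 4) *\<^sub>R integral V H"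
    unfolding S_def using cone_fubini[OF contH K(1) _ K(2)] H0 by blast+
  have 1: "(\<lambda>y. \<bar>det (matrix (P' y))\<bar> *\<^sub>R G (P y)) absolutely_integrable_on S"
    by (rule absolutely_integrable_spike[OF fub(1) negligible_empty]) (simp add: detP)
  have "integral C G = integral S (\<lambda>y. \<bar>det (matrix (P' y))\<bar> *\<^sub>R G (P y))"
    using change_of_variables_complex(2)[OF S _ injP 1] der unfolding image by blast
  also have "\<dots> = integral S (\<lambda>y. (y $ 1) ^ 3 *\<^sub>R H (tail4 y))"
    by (rule integral_cong) (rule detP)
  also have "\<dots> = (1 / 4) *\<^sub>R integral V H" by (rule fub(2))
  also have "integral V H = integral V (\<lambda>x. J x *\<^sub>R G (q x))"
    by (rule integral_cong) (simp add: H_def)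
  finally show "integral C G = (1 / 4) *\<^sub>R integral V (\<lambda>x. J x *\<^sub>R G (q x))" .
qed

text \<open>
  The integral against the volume form of \<open>S3\<close>, expressed by the radial extension of the integrand.
  The factor 4 is the inverse of \<open>\<integral> r\<^sup>3 dr\<close> over the unit interval. Here \<open>sgn\<close> is the radial
  projection, with value 0 at the origin, which is a null set.
\<close>

definition sphere_integral :: "(C2 \<Rightarrow> complex) \<Rightarrow> complex" where
  "sphere_integral g = 4 * integral (ball 0 1) (\<lambda>y::real^4. g (sgn (C2_of_R4 y)))"

lemma C2_of_R4_eq_0_iff [simp]: "C2_of_R4 y = 0 \<longleftrightarrow> y = 0"
  by (metis norm_C2_of_R4 norm_eq_zero)

lemma sgn_in_S3: "y \<noteq> 0 \<Longrightarrow> sgn (C2_of_R4 y) \<in> S3"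
  by (simp add: norm_sgn)

lemma radial_absolutely_integrable:
  fixes g :: "C2 \<Rightarrow> complex"
  assumes "continuous_on S3 g"
  shows "(\<lambda>y. g (sgn (C2_of_R4 y))) absolutely_integrable_on ball 0 1"
proof -
  have "bounded_linear C2_of_R4"
    by (simp add: linear_C2_of_R4 linear_conv_bounded_linear[symmetric])
  then have "continuous_on (ball 0 1 - {0}) (\<lambda>y. sgn (C2_of_R4 y))"
    by (intro continuous_on_sgn linear_continuous_on) auto
  then have cont: "continuous_on (ball 0 1 - {0}) (\<lambda>y. g (sgn (C2_of_R4 y)))"
    by (rule continuous_on_compose2[OF assms]) (use sgn_in_S3 in blast)
  have "compact (g ` S3)" by (intro compact_continuous_image assms) auto
  then obtain b where b: "\<And>p. p \<in> S3 \<Longrightarrow> norm (g p) \<le> b"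
    using compact_imp_bounded[of "g ` S3"] unfolding bounded_iff by blast
  have "(\<lambda>y. g (sgn (C2_of_R4 y))) absolutely_integrable_on (ball 0 1 - {0})"
  proof (rule measurable_bounded_by_integrable_imp_absolutely_integrable)
    show "(\<lambda>y. g (sgn (C2_of_R4 y))) \<in> borel_measurable (lebesgue_on (ball 0 1 - {0}))"
      by (rule continuous_imp_measurable_on_sets_lebesgue[OF cont]) auto
    have "(\<lambda>y::real^4. b) integrable_on ball 0 1"
      by (intro integrable_on_const) simp
    then show "(\<lambda>y::real^4. b) integrable_on (ball 0 1 - {0})"
      using integrable_spike_set[of "\<lambda>y. b" "ball 0 1" "ball 0 1 - {0::real^4}"]
      by (auto intro: negligible_subset[of "{0}"])
    show "norm (g (sgn (C2_of_R4 y))) \<le> b" if "y \<in> ball 0 1 - {0}" for y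
      using that b[OF sgn_in_S3] by simp
  qed auto
  then show ?thesis
    by (subst absolutely_integrable_spike_set_eq[of _ "ball 0 1 - {0}"])
       (auto intro: negligible_subset[of "{0}"])
qed

lemma radial_integrable:
  fixes g :: "C2 \<Rightarrow> complex"
  shows "continuous_on S3 g \<Longrightarrow> (\<lambda>y. g (sgn (C2_of_R4 y))) integrable_on ball 0 1"
  by (rule set_lebesgue_integral_eq_integral(1)[OF radial_absolutely_integrable])

lemma sphere_integral_cong:
  assumes "\<And>p. p \<in> S3 \<Longrightarrow> f p = g p"
  shows "sphere_integral f = sphere_integral g"
  unfolding sphere_integral_def
  by (intro arg_cong[where f="(*) 4"] integral_spike[of "{0}"]) (use assms[OF sgn_in_S3] in auto)

lemma sphere_integral_add:
  assumes "continuous_on S3 f" "continuous_on S3 g"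
  shows "sphere_integral (\<lambda>p. f p + g p) = sphere_integral f + sphere_integral g"
  unfolding sphere_integral_def
  by (simp add: integral_add radial_integrable assms distrib_left)

lemma sphere_integral_cmul: "sphere_integral (\<lambda>p. c * g p) = c * sphere_integral g"
  unfolding sphere_integral_def by simp

lemma sphere_integral_sum:
  assumes "finite I" "\<And>i. i \<in> I \<Longrightarrow> continuous_on S3 (f i)"
  shows "sphere_integral (\<lambda>p. \<Sum>i\<in>I. f i p) = (\<Sum>i\<in>I. sphere_integral (f i))"
  unfolding sphere_integral_def
  by (subst integral_sum) (auto simp: radial_integrable assms sum_distrib_left)

lemma sphere_integral_const: "sphere_integral (\<lambda>p. c) = 2 * of_real pi ^ 2 * c"
proof -
  have m: "measure lebesgue (ball (0::real^4) 1) = pi ^ 2 / 2"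
    by (simp add: content_ball unit_ball_vol_numeral fact_numeral)
  have "(\<lambda>y::real^4. 1::real) integrable_on ball 0 1"
    by (intro integrable_on_const) simp
  from integral_linear[OF this bounded_linear_scaleR_left[of c]]
  have "integral (ball (0::real^4) 1) (\<lambda>y. c) = (pi ^ 2 / 2) *\<^sub>R c"
    using m lmeasure_integral[of "ball (0::real^4) 1"] by (simp add: o_def)
  then show ?thesis
    unfolding sphere_integral_def by (simp add: scaleR_conv_of_real mult.commute)
qed

section \<open>Independence of atlas and partition of unity\<close>

lemma derivative_orthogonal_on_sphere:
  fixes \<phi> :: "'a::real_normed_vector \<Rightarrow> 'b::real_inner"
  assumes "open V" "x \<in> V" "(\<phi> has_derivative D) (at x)" "\<And>y. y \<in> V \<Longrightarrow> norm (\<phi> y) = 1"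
  shows "\<phi> x \<bullet> D h = 0"
proof -
  have "((\<lambda>y. \<phi> y \<bullet> \<phi> y) has_derivative (\<lambda>h. \<phi> x \<bullet> D h + D h \<bullet> \<phi> x)) (at x)"
    by (rule has_derivative_inner[OF assms(3,3)])
  moreover have "((\<lambda>y. \<phi> y \<bullet> \<phi> y) has_derivative (\<lambda>h. 0)) (at x)"
    by (rule has_derivative_transform_within_open[OF has_derivative_const[of 1] assms(1,2)])
       (use assms(4) in \<open>simp add: norm_eq_1\<close>)
  ultimately have "(\<lambda>h. \<phi> x \<bullet> D h + D h \<bullet> \<phi> x) = (\<lambda>h. 0)"
    by (rule has_derivative_unique)
  then have "\<phi> x \<bullet> D h + D h \<bullet> \<phi> x = 0" by meson
  then show ?thesis by (simp add: inner_commute)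
qed

text \<open>
  The 3-form \<open>\<eta>\<close> restricts to \<open>g vol\<close> on the sphere: \<open>S3_orientation p\<close> is the volume form on
  vectors orthogonal to \<open>p\<close>.
\<close>

definition represents_form :: "(C2 \<Rightarrow> complex) \<Rightarrow> C2 form3 \<Rightarrow> bool" where
  "represents_form g \<eta> \<longleftrightarrow> (\<forall>p u v w. norm p = 1 \<longrightarrow> p \<bullet> u = 0 \<longrightarrow> p \<bullet> v = 0 \<longrightarrow> p \<bullet> w = 0 \<longrightarrow>
     \<eta> p u v w = g p * of_real (S3_orientation p u v w))"

text \<open>
  The cone on the chart fills the part of the ball where the radial extension of \<open>\<rho> g\<close> is nonzero,
  up to the origin, so the contribution of one chart no longer refers to the chart.
\<close>

lemma oriented_param_integral:
  assumes param: "oriented_param S3 S3_orientation V \<phi>"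
    and \<rho>: "continuous_on S3 \<rho>" "closure {p \<in> S3. \<rho> p \<noteq> 0} \<subseteq> \<phi> ` V"
    and g: "continuous_on S3 g" and \<eta>: "represents_form g \<eta>"
  shows "integral V (\<lambda>x. \<rho> (\<phi> x) *\<^sub>R pullback_coeff \<phi> \<eta> x) = sphere_integral (\<lambda>p. \<rho> p *\<^sub>R g p)"
proof -
  have "open V" and Ck: "\<And>k. Ck_on k V \<phi>" and sub: "\<phi> ` V \<subseteq> S3"
    using param by (auto simp: oriented_param_def smooth_on_def)
  from param obtain \<psi> where \<psi>: "homeomorphism V (\<phi> ` V) \<phi> \<psi>"
    by (auto simp: oriented_param_def)
  let ?D = "\<lambda>x. frechet_derivative \<phi> (at x)"
  define q where "q x = C2_coords (\<phi> x)" for x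
  define q' where "q' x v = C2_coords (?D x v)" for x v
  define J where "J x = S3_orientation (\<phi> x) (?D x (axis 1 1)) (?D x (axis 2 1)) (?D x (axis 3 1))" for x
  define G where "G y = \<rho> (sgn (C2_of_R4 y)) *\<^sub>R g (sgn (C2_of_R4 y))" for y
  define K where "K = \<psi> ` closure {p \<in> S3. \<rho> p \<noteq> 0}"
  define C where "C = {r *\<^sub>R q x | r x. 0 < r \<and> r < 1 \<and> x \<in> V}"
  have norm\<phi>: "norm (\<phi> x) = 1" if "x \<in> V" for x
  proof -
    have "\<phi> x \<in> S3" using sub that by blast
    then show ?thesis by simp
  qed
  have sgn: "sgn (\<phi> x) = \<phi> x" if "x \<in> V" for x
    using norm\<phi>[OF that] by (simp add: sgn_div_norm)
  have Gq: "G (q x) = \<rho> (\<phi> x) *\<^sub>R g (\<phi> x)" if "x \<in> V" for x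
    by (simp add: G_def q_def sgn[OF that])
  have der: "(\<phi> has_derivative ?D x) (at x)" if "x \<in> V" for x
    by (rule Ck_on_Suc_has_derivative[OF \<open>open V\<close> Ck that])
  have bl: "bounded_linear C2_coords"
    using linear_C2_coords by (simp add: linear_conv_bounded_linear)
  have cont\<phi>: "continuous_on V \<phi>"
    using Ck Ck_on_imp_continuous_on by blast
  have contD: "continuous_on V (\<lambda>x. ?D x v)" for v
    using Ck[of "Suc 0"] by simp
  note contC = continuous_on_compose2[OF linear_continuous_on[OF bl, of UNIV] _ subset_UNIV]
  have der': "(q has_derivative q' x) (at x)" if "x \<in> V" for x
    unfolding q_def q'_def
    using has_derivative_compose[OF der[OF that] bounded_linear_imp_has_derivative[OF bl]] .
  have inj: "inj_on q V"
    using \<psi> unfolding inj_on_def q_def homeomorphism_def by (metis C2_coords_inverse)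
  have nq: "norm (q x) = 1" if "x \<in> V" for x
    using norm\<phi>[OF that] by (simp add: q_def)
  have Jeq: "J x = det (vector [q x, q' x (axis 1 1), q' x (axis 2 1), q' x (axis 3 1)] :: real^4^4)" for x
    by (simp add: J_def q_def q'_def S3_orientation_def)
  have Jpos: "0 \<le> J x" if "x \<in> V" for x
    using param that by (auto simp: oriented_param_def J_def intro: less_imp_le)
  have Ghom: "G (r *\<^sub>R y) = G y" if "0 < r" for r y
    using that by (simp add: G_def linear_scale[OF linear_C2_of_R4] sgn_scaleR)
  have contJ: "continuous_on V (\<lambda>x. J x *\<^sub>R G (q x))"
  proof -
    have "continuous_on V J"
      unfolding J_def S3_orientation_def det_4 vector_4
      by (intro continuous_intros contC cont\<phi> contD)
    moreover have "continuous_on V (\<lambda>x. \<rho> (\<phi> x) *\<^sub>R g (\<phi> x))"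
      by (intro continuous_intros continuous_on_compose2[OF \<rho>(1) cont\<phi> sub]
          continuous_on_compose2[OF g cont\<phi> sub])
    ultimately have "continuous_on V (\<lambda>x. J x *\<^sub>R (\<rho> (\<phi> x) *\<^sub>R g (\<phi> x)))"
      by (rule continuous_on_scaleR)
    then show ?thesis by (rule continuous_on_eq) (simp add: Gq)
  qed
  have "closure {p \<in> S3. \<rho> p \<noteq> 0} \<subseteq> S3"
    by (rule closure_minimal) auto
  then have "compact (closure {p \<in> S3. \<rho> p \<noteq> 0})"
    by (meson bounded_sphere bounded_subset closed_closure compact_eq_bounded_closed)
  then have cK: "compact K"
    unfolding K_def using \<psi> \<rho>(2)
    by (intro compact_continuous_image) (auto simp: homeomorphism_def intro: continuous_on_subset)
  have subK: "K \<subseteq> V"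
    unfolding K_def using \<psi> \<rho>(2) by (auto simp: homeomorphism_def)
  have G0: "G (q x) = 0" if "x \<in> V - K" for x
  proof (rule ccontr)
    assume "G (q x) \<noteq> 0"
    then have "\<phi> x \<in> {p \<in> S3. \<rho> p \<noteq> 0}" using that Gq sub by auto
    then have "\<psi> (\<phi> x) \<in> K" unfolding K_def by (intro imageI subsetD[OF closure_subset])
    then show False using \<psi> that by (auto simp: homeomorphism_def)
  qed
  have cone: "integral C G = (1 / 4) *\<^sub>R integral V (\<lambda>x. J x *\<^sub>R G (q x))"
    unfolding C_def
    by (rule cone_integral[of V q q' J G K]; (fact \<open>open V\<close> inj contJ cK subK | rule der' nq Jeq Jpos Ghom G0; assumption))
  have "{y \<in> ball 0 1 - C. G y \<noteq> 0} \<subseteq> {0}"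
  proof (rule subsetI, rule ccontr)
    fix y assume y: "y \<in> {y \<in> ball 0 1 - C. G y \<noteq> 0}" "y \<notin> {0}"
    then have "sgn (C2_of_R4 y) \<in> {p \<in> S3. \<rho> p \<noteq> 0}"
      using sgn_in_S3[of y] by (simp add: G_def)
    then have "sgn (C2_of_R4 y) \<in> \<phi> ` V" by (intro subsetD[OF \<rho>(2)] subsetD[OF closure_subset])
    then obtain x where x: "x \<in> V" "sgn (C2_of_R4 y) = \<phi> x" by auto
    have "C2_of_R4 y = norm y *\<^sub>R \<phi> x"
      using y x(2) by (simp add: sgn_div_norm flip: x(2))
    then have "y = norm y *\<^sub>R q x"
      unfolding q_def by (metis C2_of_R4_inverse linear_C2_coords linear_scale)
    then have "y \<in> C" unfolding C_def using y x(1) by force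
    then show False using y by auto
  qed
  then have n1: "negligible {y \<in> ball 0 1 - C. G y \<noteq> 0}"
    by (rule negligible_subset[OF negligible_sing])
  have "C \<subseteq> ball 0 1"
    using norm\<phi> by (auto simp: C_def q_def)
  then have "{y \<in> C - ball 0 1. G y \<noteq> 0} = {}" by auto
  then have n2: "negligible {y \<in> C - ball 0 1. G y \<noteq> 0}" by (simp only: negligible_empty)
  have "sphere_integral (\<lambda>p. \<rho> p *\<^sub>R g p) = 4 * integral (ball 0 1) G"
    by (simp add: sphere_integral_def G_def[abs_def])
  also have "integral (ball 0 1) G = integral C G"
    by (rule integral_spike_set[OF n1 n2])
  also have "4 * \<dots> = integral V (\<lambda>x. J x *\<^sub>R G (q x))"
    unfolding cone by (simp add: scaleR_conv_of_real)
  also have "\<dots> = integral V (\<lambda>x. \<rho> (\<phi> x) *\<^sub>R pullback_coeff \<phi> \<eta> x)"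
  proof (rule integral_cong)
    fix x assume x: "x \<in> V"
    have "\<phi> x \<bullet> ?D x h = 0" for h
      using derivative_orthogonal_on_sphere[OF \<open>open V\<close> x der[OF x] norm\<phi>] .
    then have "pullback_coeff \<phi> \<eta> x = g (\<phi> x) * of_real (J x)"
      using \<eta> norm\<phi>[OF x] unfolding represents_form_def pullback_coeff_def J_def by blast
    then show "J x *\<^sub>R G (q x) = \<rho> (\<phi> x) *\<^sub>R pullback_coeff \<phi> \<eta> x"
      by (simp add: Gq[OF x] scaleR_conv_of_real)
  qed
  finally show ?thesis ..
qed

section \<open>The stereographic atlas\<close>

text \<open>
  Stereographic projection from the pole \<open>(0, \<i>)\<close>, the fourth coordinate vector of \<open>\<real>\<^sup>4\<close>. With this
  pole the parametrization is positively oriented. The second chart is \<open>- stereo\<close>; it has the same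
  orientation because the antipodal map of \<open>\<real>\<^sup>4\<close> has determinant 1.
\<close>

definition embed3 :: "real^3 \<Rightarrow> C2" where
  "embed3 x = (Complex (x$1) (x$2), Complex (x$3) 0)"

definition stereo :: "real^3 \<Rightarrow> C2" where
  "stereo x = inverse (x \<bullet> x + 1) *\<^sub>R (2 *\<^sub>R embed3 x + (x \<bullet> x - 1) *\<^sub>R (0, \<i>))"

definition stereo_inv :: "C2 \<Rightarrow> real^3" where
  "stereo_inv p = inverse (1 - Im (snd p)) *\<^sub>R vector [Re (fst p), Im (fst p), Re (snd p)]"

lemma linear_embed3: "linear embed3"
  by (rule linearI) (simp_all add: embed3_def prod_eq_iff complex_eq_iff)

lemma inner_R3: "x \<bullet> x = (x$1)\<^sup>2 + (x$2)\<^sup>2 + (x$3)\<^sup>2" for x :: "real^3"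
  by (simp add: inner_vec_def sum_3 power2_eq_square)

lemma inner_plus_1_pos: "0 < x \<bullet> x + (1::real)" for x :: "'a::real_inner"
  using inner_ge_zero[of x] by linarith

lemma stereo_components:
  "Re (fst (stereo x)) = 2 * x$1 / (x \<bullet> x + 1)" "Im (fst (stereo x)) = 2 * x$2 / (x \<bullet> x + 1)"
  "Re (snd (stereo x)) = 2 * x$3 / (x \<bullet> x + 1)" "Im (snd (stereo x)) = (x \<bullet> x - 1) / (x \<bullet> x + 1)"
  by (simp_all add: stereo_def embed3_def divide_inverse mult.commute)

lemma norm_stereo: "norm (stereo x) = 1"
proof -
  have "stereo x \<bullet> stereo x = (4 * ((x$1)\<^sup>2 + (x$2)\<^sup>2 + (x$3)\<^sup>2) + (x \<bullet> x - 1)\<^sup>2) / (x \<bullet> x + 1)\<^sup>2"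
    by (simp add: inner_prod_def inner_complex_def stereo_components add_divide_distrib power_divide power_mult_distrib
        flip: power2_eq_square)
  also have "\<dots> = 1"
  proof -
    have "4 * (x \<bullet> x) + (x \<bullet> x - 1)\<^sup>2 = (x \<bullet> x + 1)\<^sup>2" by (simp add: power2_eq_square algebra_simps)
    then show ?thesis
      using inner_plus_1_pos[of x] unfolding inner_R3[symmetric] by simp
  qed
  finally show ?thesis by (simp add: norm_eq_1)
qed

lemma stereo_inv_stereo: "stereo_inv (stereo x) = x"
proof -
  have "x \<bullet> x + 1 \<noteq> 0" using inner_plus_1_pos[of x] by simp
  moreover from this have "1 - Im (snd (stereo x)) = 2 / (x \<bullet> x + 1)"
    by (simp add: stereo_components field_simps)
  ultimately show ?thesis
    by (simp add: stereo_inv_def vec_eq_iff forall_3) (simp add: stereo_components)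
qed

lemma stereo_stereo_inv:
  assumes "norm p = 1" "Im (snd p) \<noteq> 1"
  shows "stereo (stereo_inv p) = p"
proof -
  define k where "k = 1 - Im (snd p)"
  have k: "k \<noteq> 0" using assms(2) by (simp add: k_def)
  have s: "(Re (fst p))\<^sup>2 + (Im (fst p))\<^sup>2 + (Re (snd p))\<^sup>2 = 1 - (Im (snd p))\<^sup>2"
    using assms(1) by (simp add: norm_eq_1 inner_prod_def inner_complex_def power2_eq_square)
  have "stereo_inv p \<bullet> stereo_inv p = ((Re (fst p))\<^sup>2 + (Im (fst p))\<^sup>2 + (Re (snd p))\<^sup>2) / k\<^sup>2"
    unfolding inner_R3 by (simp add: stereo_inv_def k_def[symmetric] power_mult_distrib divide_inverse power_inverse algebra_simps)
  also have "\<dots> = (1 + Im (snd p)) / k"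
  proof -
    have "1 - (Im (snd p))\<^sup>2 = (1 + Im (snd p)) * k" by (simp add: k_def power2_eq_square algebra_simps)
    then show ?thesis unfolding s using k by (simp add: power2_eq_square)
  qed
  finally have ii: "stereo_inv p \<bullet> stereo_inv p = (1 + Im (snd p)) / k" .
  then have "stereo_inv p \<bullet> stereo_inv p + 1 = 2 / k" "stereo_inv p \<bullet> stereo_inv p - 1 = 2 * Im (snd p) / k"
    using k by (simp_all add: k_def field_simps)
  then show ?thesis using k
    by (auto simp: prod_eq_iff complex_eq_iff stereo_components)
       (simp_all add: stereo_inv_def k_def[symmetric])
qed

lemma stereo_neq_pole: "Im (snd (stereo x)) \<noteq> 1"
  using inner_plus_1_pos[of x] by (simp add: stereo_components divide_eq_eq)

definition stereo_deriv :: "real^3 \<Rightarrow> real^3 \<Rightarrow> C2" where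
  "stereo_deriv x v = inverse (x \<bullet> x + 1) *\<^sub>R (2 *\<^sub>R embed3 v + (2 * (x \<bullet> v)) *\<^sub>R (0, \<i>))
     - (2 * (x \<bullet> v) * inverse (x \<bullet> x + 1)) *\<^sub>R stereo x"

lemma stereo_has_derivative: "(stereo has_derivative stereo_deriv x) (at x)"
proof -
  have ne: "x \<bullet> x + 1 \<noteq> 0" using inner_plus_1_pos[of x] by simp
  have bl: "bounded_linear embed3" using linear_embed3 by (simp add: linear_conv_bounded_linear)
  show ?thesis
    unfolding stereo_def[abs_def]
    by (rule has_derivative_eq_rhs, (rule derivative_intros bounded_linear_imp_has_derivative[OF bl] ne)+)
       (auto simp: fun_eq_iff stereo_deriv_def stereo_def inner_commute algebra_simps)
qed

lemma smooth_on_stereo: "smooth_on UNIV stereo"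
  unfolding smooth_on_def
proof (intro conjI allI)
  fix k
  have ne: "x \<bullet> x + 1 \<noteq> 0" for x :: "real^3" using inner_plus_1_pos[of x] by simp
  have id: "Ck_on k UNIV (\<lambda>x::real^3. x)"
    by (intro Ck_on_linear) (auto simp: linear_iff)
  note ck = Ck_on_add Ck_on_scaleR Ck_on_const Ck_on_inner id Ck_on_linear[OF _ linear_embed3]
  have "Ck_on k UNIV (\<lambda>x::real^3. inverse (x \<bullet> x + 1) *\<^sub>R (2 *\<^sub>R embed3 x + (x \<bullet> x + - 1) *\<^sub>R (0::complex, \<i>)))"
    by (intro Ck_on_scaleR Ck_on_inverse ne ck open_UNIV)
  then show "Ck_on k UNIV stereo"
    unfolding stereo_def[abs_def] by simp
qed simp


text \<open>
  The matrix of \<open>stereo x\<close> and its partial derivatives, with \<open>s = stereo x\<close>: the derivative of the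
  factor \<open>d = 1 / (x \<bullet> x + 1)\<close> only adds the multiples \<open>c\<^sub>i s\<close> of the first row.
\<close>

lemma stereo_det:
  fixes d :: real
  shows "det (vector [vector [s1, s2, s3, s4],
      vector [2 * d - c1 * s1, - c1 * s2, - c1 * s3, 2 * d * x1 - c1 * s4],
      vector [- c2 * s1, 2 * d - c2 * s2, - c2 * s3, 2 * d * x2 - c2 * s4],
      vector [- c3 * s1, - c3 * s2, 2 * d - c3 * s3, 2 * d * x3 - c3 * s4]] :: real^4^4)
    = 8 * d ^ 3 * (x1 * s1 + x2 * s2 + x3 * s3 - s4)"
  unfolding det_4 vector_4 by (simp add: power3_eq_cube algebra_simps)

lemma stereo_oriented:
  "0 < S3_orientation (stereo x) (stereo_deriv x (axis 1 1)) (stereo_deriv x (axis 2 1)) (stereo_deriv x (axis 3 1))"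
proof -
  define d where "d = inverse (x \<bullet> x + 1)"
  define c where "c i = 2 * x $ i * d" for i
  define s where "s i = C2_coords (stereo x) $ i" for i
  have d: "0 < d" using inner_plus_1_pos[of x] by (simp add: d_def)
  have C2: "C2_coords (stereo_deriv x (axis i 1)) $ j =
      d * (2 * C2_coords (embed3 (axis i 1)) $ j + 2 * x $ i * C2_coords (0, \<i>) $ j) - c i * s j" for i j
    by (simp add: stereo_deriv_def linear_diff[OF linear_C2_coords] linear_add[OF linear_C2_coords]
        linear_scale[OF linear_C2_coords] inner_axis d_def c_def s_def del: scaleR_Pair)
  have E: "C2_coords (embed3 (axis 1 1)) = axis 1 1" "C2_coords (embed3 (axis 2 1)) = axis 2 1"
     "C2_coords (embed3 (axis 3 1)) = axis 3 1" "C2_coords (0, \<i>) = axis 4 1"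
    by (simp_all add: embed3_def C2_coords_def vec_eq_iff forall_4) (simp_all add: axis_def)
  have rows: "C2_coords (stereo x) = vector [s 1, s 2, s 3, s 4]"
    "C2_coords (stereo_deriv x (axis 1 1)) = vector [2 * d - c 1 * s 1, - c 1 * s 2, - c 1 * s 3, 2 * d * x$1 - c 1 * s 4]"
    "C2_coords (stereo_deriv x (axis 2 1)) = vector [- c 2 * s 1, 2 * d - c 2 * s 2, - c 2 * s 3, 2 * d * x$2 - c 2 * s 4]"
    "C2_coords (stereo_deriv x (axis 3 1)) = vector [- c 3 * s 1, - c 3 * s 2, 2 * d - c 3 * s 3, 2 * d * x$3 - c 3 * s 4]"
    by (simp_all add: vec_eq_iff forall_4 C2 E) (simp_all add: s_def axis_def)
  have s: "s 1 = 2 * x$1 / (x \<bullet> x + 1)" "s 2 = 2 * x$2 / (x \<bullet> x + 1)" "s 3 = 2 * x$3 / (x \<bullet> x + 1)"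
    "s 4 = (x \<bullet> x - 1) / (x \<bullet> x + 1)"
    by (simp_all add: s_def C2_coords_def stereo_components)
  have "x$1 * s 1 + x$2 * s 2 + x$3 * s 3 - s 4 = (2 * ((x$1)\<^sup>2 + (x$2)\<^sup>2 + (x$3)\<^sup>2) - (x \<bullet> x - 1)) / (x \<bullet> x + 1)"
    unfolding s by (simp add: add_divide_distrib diff_divide_distrib power2_eq_square mult_ac)
  also have "\<dots> = 1"
    using inner_plus_1_pos[of x] unfolding inner_R3[symmetric] by simp
  finally show ?thesis
    unfolding S3_orientation_def rows stereo_det using d by simp
qed

lemma frechet_derivative_scaled_stereo:
  "frechet_derivative (\<lambda>x. \<sigma> *\<^sub>R stereo x) (at x) = (\<lambda>v. \<sigma> *\<^sub>R stereo_deriv x v)"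
  using frechet_derivative_at[OF has_derivative_scaleR_right[OF stereo_has_derivative]] by metis

lemma oriented_param_stereo:
  assumes \<sigma>: "\<sigma> = 1 \<or> \<sigma> = -1"
  shows "oriented_param S3 S3_orientation UNIV (\<lambda>x. \<sigma> *\<^sub>R stereo x)"
    and "range (\<lambda>x. \<sigma> *\<^sub>R stereo x) = {p \<in> S3. Im (snd p) \<noteq> \<sigma>}"
proof -
  have \<sigma>2: "\<sigma> * \<sigma> = 1" "\<bar>\<sigma>\<bar> = 1" using \<sigma> by auto
  show image: "range (\<lambda>x. \<sigma> *\<^sub>R stereo x) = {p \<in> S3. Im (snd p) \<noteq> \<sigma>}"
  proof
    show "range (\<lambda>x. \<sigma> *\<^sub>R stereo x) \<subseteq> {p \<in> S3. Im (snd p) \<noteq> \<sigma>}"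
      using norm_stereo stereo_neq_pole \<sigma> by auto
    show "{p \<in> S3. Im (snd p) \<noteq> \<sigma>} \<subseteq> range (\<lambda>x. \<sigma> *\<^sub>R stereo x)"
    proof
      fix p assume "p \<in> {p \<in> S3. Im (snd p) \<noteq> \<sigma>}"
      then have p: "norm (\<sigma> *\<^sub>R p) = 1" "Im (snd (\<sigma> *\<^sub>R p)) \<noteq> 1"
        using \<sigma> by (auto simp: \<sigma>2)
      have "p = \<sigma> *\<^sub>R stereo (stereo_inv (\<sigma> *\<^sub>R p))"
        unfolding stereo_stereo_inv[OF p] by (simp add: \<sigma>2)
      then show "p \<in> range (\<lambda>x. \<sigma> *\<^sub>R stereo x)" by blast
    qed
  qed
  have smooth: "smooth_on UNIV (\<lambda>x. \<sigma> *\<^sub>R stereo x)"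
    using smooth_on_stereo unfolding smooth_on_def
    by (intro conjI allI Ck_on_scaleR Ck_on_const open_UNIV) simp
  show "oriented_param S3 S3_orientation UNIV (\<lambda>x. \<sigma> *\<^sub>R stereo x)"
    unfolding oriented_param_def image
  proof (intro conjI ballI)
    show "smooth_on UNIV (\<lambda>x. \<sigma> *\<^sub>R stereo x)" by (rule smooth)
    show "{p \<in> S3. Im (snd p) \<noteq> \<sigma>} \<subseteq> S3" by blast
    have "{p \<in> S3. Im (snd p) \<noteq> \<sigma>} = S3 \<inter> {p. Im (snd p) \<noteq> \<sigma>}" by blast
    moreover have "open {p::C2. Im (snd p) \<noteq> \<sigma>}"
      by (intro open_Collect_neq continuous_intros)
    ultimately show "openin (top_of_set S3) {p \<in> S3. Im (snd p) \<noteq> \<sigma>}"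
      by (simp add: openin_open_Int)
    show "\<exists>\<psi>. homeomorphism UNIV {p \<in> S3. Im (snd p) \<noteq> \<sigma>} (\<lambda>x. \<sigma> *\<^sub>R stereo x) \<psi>"
    proof (intro exI homeomorphismI)
      show "continuous_on UNIV (\<lambda>x. \<sigma> *\<^sub>R stereo x)"
        using smooth unfolding smooth_on_def by (meson Ck_on.simps(1))
      have "linear (\<lambda>p::C2. vector [Re (fst p), Im (fst p), Re (snd p)] :: real^3)"
        by (rule linearI) (simp_all add: vec_eq_iff forall_3)
      then have proj: "continuous_on UNIV (\<lambda>p::C2. vector [Re (fst p), Im (fst p), Re (snd p)] :: real^3)"
        by (intro linear_continuous_on) (simp add: linear_conv_bounded_linear)
      have "Im (snd (\<sigma> *\<^sub>R p)) \<noteq> 1" if "Im (snd p) \<noteq> \<sigma>" for p :: C2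
        using that \<sigma> by auto
      then show "continuous_on {p \<in> S3. Im (snd p) \<noteq> \<sigma>} (\<lambda>p. stereo_inv (\<sigma> *\<^sub>R p))"
        unfolding stereo_inv_def
        by (intro continuous_intros continuous_on_compose2[OF proj _ subset_UNIV]) auto
      show "(\<lambda>x. \<sigma> *\<^sub>R stereo x) ` UNIV \<subseteq> {p \<in> S3. Im (snd p) \<noteq> \<sigma>}" using image by simp
      show "stereo_inv (\<sigma> *\<^sub>R \<sigma> *\<^sub>R stereo x) = x" for x by (simp add: \<sigma>2 stereo_inv_stereo)
      show "\<sigma> *\<^sub>R stereo (stereo_inv (\<sigma> *\<^sub>R p)) = p" if "p \<in> {p \<in> S3. Im (snd p) \<noteq> \<sigma>}" for p
      proof -
        have p: "norm (\<sigma> *\<^sub>R p) = 1" "Im (snd (\<sigma> *\<^sub>R p)) \<noteq> 1"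
          using that \<sigma> by (auto simp: \<sigma>2)
        show ?thesis unfolding stereo_stereo_inv[OF p] by (simp add: \<sigma>2)
      qed
    qed simp
    show "0 < S3_orientation (\<sigma> *\<^sub>R stereo x)
          (frechet_derivative (\<lambda>x. \<sigma> *\<^sub>R stereo x) (at x) (axis 1 1))
          (frechet_derivative (\<lambda>x. \<sigma> *\<^sub>R stereo x) (at x) (axis 2 1))
          (frechet_derivative (\<lambda>x. \<sigma> *\<^sub>R stereo x) (at x) (axis 3 1))" for x
    proof -
      have neg: "S3_orientation (- p) (- u) (- v) (- w) = S3_orientation p u v w" for p u v w
        by (simp add: S3_orientation_def det_4 linear_neg[OF linear_C2_coords] algebra_simps)
      have "S3_orientation (\<sigma> *\<^sub>R p) (\<sigma> *\<^sub>R u) (\<sigma> *\<^sub>R v) (\<sigma> *\<^sub>R w) = S3_orientation p u v w" for p u v w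
        by (rule disjE[OF \<sigma>]) (simp_all add: neg)
      then show ?thesis
        unfolding frechet_derivative_scaled_stereo using stereo_oriented by simp
    qed
  qed
qed

lemma ex_subordinate_partition:
  "\<exists>n V \<phi> \<rho>. subordinate_partition S3 S3_orientation n V \<phi> \<rho>"
proof -
  define \<sigma> :: "nat \<Rightarrow> real" where "\<sigma> i = (if i = 0 then 1 else -1)" for i
  \<comment> \<open>A cutoff in the fourth coordinate, which vanishes from 1/2 upwards and is 1 from -1/2 downwards.\<close>
  define \<rho>0 :: "C2 \<Rightarrow> real" where "\<rho>0 p = max 0 (min 1 (1 / 2 - Im (snd p)))" for p
  define \<rho> :: "nat \<Rightarrow> C2 \<Rightarrow> real" where "\<rho> i p = (if i = 0 then \<rho>0 p else 1 - \<rho>0 p)" for i p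
  have \<sigma>: "\<sigma> i = 1 \<or> \<sigma> i = -1" for i by (simp add: \<sigma>_def)
  have cont0: "continuous_on S3 \<rho>0"
    unfolding \<rho>0_def[abs_def] by (intro continuous_intros)
  have cont: "continuous_on S3 (\<rho> i)" for i
    unfolding \<rho>_def[abs_def] using cont0 by (cases "i = 0") (auto intro!: continuous_intros)
  have closed: "closed (S3 \<inter> {p. - (1 / 2) \<le> - \<sigma> i * Im (snd p)})" for i
    by (intro closed_Int closed_sphere closed_Collect_le continuous_intros)
  have "{p \<in> S3. \<rho> i p \<noteq> 0} \<subseteq> S3 \<inter> {p. - (1 / 2) \<le> - \<sigma> i * Im (snd p)}" for i
    by (auto simp: \<rho>_def \<rho>0_def \<sigma>_def max_def min_def split: if_splits)
  then have "closure {p \<in> S3. \<rho> i p \<noteq> 0} \<subseteq> S3 \<inter> {p. - (1 / 2) \<le> - \<sigma> i * Im (snd p)}" for i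
    using closure_minimal closed by blast
  also have "S3 \<inter> {p. - (1 / 2) \<le> - \<sigma> i * Im (snd p)} \<subseteq> {p \<in> S3. Im (snd p) \<noteq> \<sigma> i}" for i
    using \<sigma>[of i] by auto
  finally have cl: "closure {p \<in> S3. \<rho> i p \<noteq> 0} \<subseteq> {p \<in> S3. Im (snd p) \<noteq> \<sigma> i}" for i .
  have "subordinate_partition S3 S3_orientation 2 (\<lambda>_. UNIV) (\<lambda>i x. \<sigma> i *\<^sub>R stereo x) \<rho>"
    unfolding subordinate_partition_def
  proof (intro conjI allI impI ballI)
    fix i :: nat
    show "oriented_param S3 S3_orientation UNIV (\<lambda>x. \<sigma> i *\<^sub>R stereo x)"
      by (rule oriented_param_stereo(1)[OF \<sigma>])
    show "continuous_on S3 (\<rho> i)" by (rule cont)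
    show "0 \<le> \<rho> i p" for p by (simp add: \<rho>_def \<rho>0_def)
    show "closure {p \<in> S3. \<rho> i p \<noteq> 0} \<subseteq> range (\<lambda>x. \<sigma> i *\<^sub>R stereo x)"
      unfolding oriented_param_stereo(2)[OF \<sigma>] by (rule cl)
    show "(\<Sum>i<2. \<rho> i p) = 1" for p by (simp add: \<rho>_def numeral_2_eq_2)
  qed
  then show ?thesis by blast
qed

lemma form_integral_S3:
  assumes g: "continuous_on S3 g" and \<eta>: "represents_form g \<eta>"
  shows "form_integral S3 S3_orientation \<eta> = sphere_integral g"
proof -
  have *: "(\<Sum>i<n. integral (V i) (\<lambda>x. \<rho> i (\<phi> i x) *\<^sub>R pullback_coeff (\<phi> i) \<eta> x)) = sphere_integral g"
    if P: "subordinate_partition S3 S3_orientation n V \<phi> \<rho>" for n V \<phi> \<rho>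
  proof -
    have "(\<Sum>i<n. integral (V i) (\<lambda>x. \<rho> i (\<phi> i x) *\<^sub>R pullback_coeff (\<phi> i) \<eta> x))
        = (\<Sum>i<n. sphere_integral (\<lambda>p. \<rho> i p *\<^sub>R g p))"
      using P by (intro sum.cong refl oriented_param_integral g \<eta>) (auto simp: subordinate_partition_def)
    also have "\<dots> = sphere_integral (\<lambda>p. \<Sum>i<n. \<rho> i p *\<^sub>R g p)"
      using P g by (subst sphere_integral_sum) (auto simp: subordinate_partition_def intro!: continuous_on_scaleR)
    also have "\<dots> = sphere_integral g"
      using P by (intro sphere_integral_cong) (simp add: subordinate_partition_def flip: scaleR_sum_left)
    finally show ?thesis .
  qed
  obtain n V \<phi> \<rho> where "subordinate_partition S3 S3_orientation n V \<phi> \<rho>"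
    using ex_subordinate_partition by blast
  then show ?thesis
    unfolding form_integral_def
    by (intro the_equality exI conjI) (auto simp: *)
qed

section \<open>Derivatives along the frame integrate to zero\<close>

lemma sphere_integral_rot:
  fixes g :: "C2 \<Rightarrow> complex"
  assumes J: "orthogonal_complex_structure J" and g: "continuous_on S3 g"
  shows "sphere_integral (\<lambda>p. g (rot J t p)) = sphere_integral g"
proof -
  define R where "R y = C2_coords (rot J t (C2_of_R4 y))" for y
  let ?f = "\<lambda>y. g (sgn (C2_of_R4 y))"
  have lin: "linear (rot J t)"
    using orthogonal_rot[OF J] by (rule orthogonal_transformation_linear)
  have linR: "linear R"
    using linear_compose[OF linear_compose[OF linear_C2_of_R4 lin] linear_C2_coords]
    by (simp add: R_def[abs_def] o_def)
  have R: "orthogonal_transformation R"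
    unfolding orthogonal_transformation
    using linR by (simp add: R_def norm_rot[OF J])
  have blR: "bounded_linear R"
    using linR by (simp add: linear_conv_bounded_linear)
  have fR: "?f (R y) = g (rot J t (sgn (C2_of_R4 y)))" for y
    by (simp add: R_def sgn_div_norm norm_rot[OF J] linear_scale[OF lin])
  have "continuous_on S3 (rot J t)"
    using lin by (intro linear_continuous_on) (simp add: linear_conv_bounded_linear)
  then have grot: "continuous_on S3 (\<lambda>p. g (rot J t p))"
    by (rule continuous_on_compose2[OF g]) (auto simp: norm_rot[OF J] simp del: mem_sphere split_paired_all)
  have "(\<lambda>y. \<bar>det (matrix R)\<bar> *\<^sub>R ?f (R y)) absolutely_integrable_on ball 0 1"
    unfolding fR using radial_absolutely_integrable[OF grot] by (simp add: R)
  from change_of_variables_complex(2)[OF _ bounded_linear_imp_has_derivative[OF blR] _ this]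
  have "integral (R ` ball 0 1) ?f = integral (ball 0 1) (\<lambda>y. \<bar>det (matrix R)\<bar> *\<^sub>R ?f (R y))"
    using orthogonal_transformation_inj[OF R] by (simp add: inj_on_subset)
  also have "R ` ball 0 1 = ball 0 1"
    using image_orthogonal_transformation_ball[OF R, of 0 1] by (simp add: linear_0[OF linR])
  finally show ?thesis
    unfolding sphere_integral_def fR by (simp add: R)
qed

lemma sphere_integral_punctured:
  "sphere_integral g = 4 * integral (ball 0 1 - {0}) (\<lambda>y::real^4. g (sgn (C2_of_R4 y)))"
  unfolding sphere_integral_def
  by (intro arg_cong[where f="(*) 4"] integral_spike_set) (auto intro: negligible_subset[of "{0}"])

lemma sphere_integral_dominated_convergence:
  fixes f :: "nat \<Rightarrow> C2 \<Rightarrow> complex"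
  assumes f: "\<And>k. continuous_on S3 (f k)" and le: "\<And>k p. p \<in> S3 \<Longrightarrow> norm (f k p) \<le> B"
    and lim: "\<And>p. p \<in> S3 \<Longrightarrow> (\<lambda>k. f k p) \<longlonglongrightarrow> g p"
  shows "(\<lambda>k. sphere_integral (f k)) \<longlonglongrightarrow> sphere_integral g"
proof -
  have spike: "h integrable_on ball 0 1 - {0}" if "h integrable_on ball 0 1" for h :: "real^4 \<Rightarrow> 'b::euclidean_space"
    using that by (rule integrable_spike_set) (auto intro: negligible_subset[of "{0}"])
  have const: "(\<lambda>y::real^4. B) integrable_on ball 0 1"
    by (intro integrable_on_const) simp
  have "(\<lambda>k. integral (ball 0 1 - {0}) (\<lambda>y. f k (sgn (C2_of_R4 y)))) \<longlonglongrightarrow>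
      integral (ball 0 1 - {0}) (\<lambda>y::real^4. g (sgn (C2_of_R4 y)))"
  proof (rule dominated_convergence(2)[where h="\<lambda>_. B"])
    show "(\<lambda>y. f k (sgn (C2_of_R4 y))) integrable_on ball 0 1 - {0}" for k
      by (rule spike[OF radial_integrable[OF f]])
    show "(\<lambda>y::real^4. B) integrable_on ball 0 1 - {0}"
      by (rule spike[OF const])
    show "norm (f k (sgn (C2_of_R4 y))) \<le> B" if "y \<in> ball 0 1 - {0}" for k y
      using that by (intro le sgn_in_S3) simp
    show "(\<lambda>k. f k (sgn (C2_of_R4 y))) \<longlonglongrightarrow> g (sgn (C2_of_R4 y))" if "y \<in> ball 0 1 - {0}" for y
      using that by (intro lim sgn_in_S3) simp
  qed
  then show ?thesis
    unfolding sphere_integral_punctured by (intro tendsto_mult_left)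
qed

text \<open>
  By rotation invariance the difference quotients of \<open>f\<close> along the flow of \<open>J\<close> have integral zero.
  The mean value theorem bounds them by the maximum of the derivative on the sphere, so dominated
  convergence applies.
\<close>

lemma sphere_integral_derivative:
  fixes f :: "C2 \<Rightarrow> complex"
  assumes J: "orthogonal_complex_structure J" and U: "open U" "S3 \<subseteq> U" and f: "Ck_on (Suc 0) U f"
  shows "sphere_integral (\<lambda>p. frechet_derivative f (at p) (J p)) = 0"
proof -
  define g where "g p = frechet_derivative f (at p) (J p)" for p
  define F where "F k p = of_nat (Suc k) * (f (rot J (inverse (Suc k)) p) - f p)" for k p
  have contJ: "continuous_on X J" for X
    using complex_structure_linear[OF J] by (intro linear_continuous_on) (simp add: linear_conv_bounded_linear)
  have contf: "continuous_on S3 f"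
    using Ck_on_imp_continuous_on[OF f] U(2) continuous_on_subset by blast
  have contg: "continuous_on S3 g"
    unfolding g_def using continuous_on_frechet_derivative[OF U(1) f contJ] U(2) continuous_on_subset by blast
  have rotS: "rot J t p \<in> S3" if "p \<in> S3" for t p
    using that norm_rot[OF J] by simp
  have "compact (g ` S3)" by (intro compact_continuous_image contg) simp
  then obtain B where B: "\<And>p. p \<in> S3 \<Longrightarrow> norm (g p) \<le> B"
    using compact_imp_bounded[of "g ` S3"] unfolding bounded_iff by blast
  have der: "((\<lambda>t. f (rot J t p)) has_vector_derivative g (rot J t p)) (at t within X)" if "p \<in> S3" for t p X
    unfolding g_def using that rotS U
    by (intro has_derivative_along_rot[OF J] Ck_on_Suc_has_derivative[OF U(1) f]) blast
  have controt: "continuous_on S3 (\<lambda>p. f (rot J t p))" for t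
  proof (rule continuous_on_compose2[OF contf])
    show "continuous_on S3 (rot J t)"
      unfolding rot_def[abs_def] by (intro continuous_intros contJ)
    show "rot J t ` S3 \<subseteq> S3" using rotS by blast
  qed
  have "(\<lambda>k. sphere_integral (F k)) \<longlonglongrightarrow> sphere_integral g"
  proof (rule sphere_integral_dominated_convergence)
    show "continuous_on S3 (F k)" for k
      unfolding F_def by (intro continuous_intros controt contf)
    show "norm (F k p) \<le> B" if p: "p \<in> S3" for k p
    proof -
      let ?s = "inverse (real (Suc k))"
      have "norm (f (rot J ?s p) - f (rot J 0 p)) \<le> B * norm (?s - 0)"
      proof (rule differentiable_bound[where S=UNIV and f'="\<lambda>t h. h *\<^sub>R g (rot J t p)"])
        show "((\<lambda>t. f (rot J t p)) has_derivative (\<lambda>h. h *\<^sub>R g (rot J t p))) (at t within UNIV)" for t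
          using der[OF p] by (simp add: has_vector_derivative_def)
        show "onorm (\<lambda>h. h *\<^sub>R g (rot J t p)) \<le> B" for t
        proof (rule onorm_le)
          show "norm (h *\<^sub>R g (rot J t p)) \<le> B * norm h" for h
            using mult_right_mono[OF B[OF rotS[OF p, of t]], of "norm h"] by (simp add: mult.commute)
        qed
      qed auto
      then have "of_nat (Suc k) * norm (f (rot J ?s p) - f p) \<le> B"
        by (simp add: rot_0[OF J] field_simps del: of_nat_Suc)
      then show ?thesis by (simp add: F_def norm_mult del: of_nat_Suc)
    qed
    show "(\<lambda>k. F k p) \<longlonglongrightarrow> g p" if p: "p \<in> S3" for p
    proof -
      have "((\<lambda>t. f (rot J t p)) has_derivative (\<lambda>h. h *\<^sub>R g p)) (at 0)"
        using der[OF p, of 0 UNIV] by (simp add: has_vector_derivative_def rot_0[OF J])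
      then have "((\<lambda>h. norm (f (rot J h p) - f p - h *\<^sub>R g p) / norm h) \<longlongrightarrow> 0) (at 0)"
        by (simp add: has_derivative_at rot_0[OF J])
      moreover have "filterlim (\<lambda>k. inverse (real (Suc k))) (at 0) sequentially"
        using LIMSEQ_inverse_real_of_nat by (auto simp: filterlim_at)
      ultimately have "(\<lambda>k. norm (f (rot J (inverse (Suc k)) p) - f p - inverse (real (Suc k)) *\<^sub>R g p) / norm (inverse (real (Suc k)))) \<longlonglongrightarrow> 0"
        by (rule filterlim_compose)
      also have "(\<lambda>k. norm (f (rot J (inverse (Suc k)) p) - f p - inverse (real (Suc k)) *\<^sub>R g p) / norm (inverse (real (Suc k))))
          = (\<lambda>k. norm (F k p - g p))"
      proof
        fix k
        let ?n = "real (Suc k)"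
        have "F k p - g p = ?n *\<^sub>R (f (rot J (inverse ?n) p) - f p - inverse ?n *\<^sub>R g p)"
          unfolding F_def by (simp add: scaleR_conv_of_real right_diff_distrib del: of_nat_Suc)
        then show "norm (f (rot J (inverse ?n) p) - f p - inverse ?n *\<^sub>R g p) / norm (inverse ?n) = norm (F k p - g p)"
          by (simp add: divide_inverse mult.commute del: of_nat_Suc)
      qed
      finally show ?thesis
        by (simp add: tendsto_norm_zero_iff LIM_zero_iff)
    qed
  qed
  moreover have "sphere_integral (F k) = 0" for k
  proof -
    have "sphere_integral (F k) =
        sphere_integral (\<lambda>p. of_nat (Suc k) * (f (rot J (inverse (Suc k)) p) + (-1) * f p))"
      by (simp add: F_def[abs_def])
    also have "\<dots> = of_nat (Suc k) *
        (sphere_integral (\<lambda>p. f (rot J (inverse (Suc k)) p)) + sphere_integral (\<lambda>p. (-1) * f p))"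
      by (subst sphere_integral_cmul, subst sphere_integral_add)
         (auto intro!: controt continuous_on_minus contf)
    finally show ?thesis
      unfolding sphere_integral_rot[OF J contf] sphere_integral_cmul by simp
  qed
  ultimately have "sphere_integral g = 0" by (simp add: LIMSEQ_const_iff)
  then show ?thesis by (simp add: g_def[abs_def])
qed

section \<open>The forms with \<open>d\<omega> = \<alpha> \<and> \<omega>\<close>\<close>

text \<open>
  The value of \<open>omega a\<close> on the vector field \<open>J2\<close>; on \<open>J3\<close> the value is \<open>\<i>\<close> times as large.
\<close>

definition omega_J2 :: "complex \<Rightarrow> C2 \<Rightarrow> complex" where
  "omega_J2 a p = a * (fst p * cnj (fst p)) + (1 - a) * (snd p * cnj (snd p))"

text \<open>
  A solution of \<open>d\<omega> = \<alpha> \<and> \<omega>\<close> on the sphere: \<open>(A dz\<^sub>1 + B dz\<^sub>2) \<and> \<omega> = (a A z\<^sub>1 + (1 - a) B z\<^sub>2) dz\<^sub>1 \<and> dz\<^sub>2\<close>,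
  and the coefficient is \<open>\<bar>z\<^sub>1\<bar>\<^sup>2 + \<bar>z\<^sub>2\<bar>\<^sup>2 = 1\<close> for \<open>A = cnj z\<^sub>1 / a\<close> and \<open>B = cnj z\<^sub>2 / (1 - a)\<close>.
\<close>

definition alpha0 :: "complex \<Rightarrow> C2 form1" where
  "alpha0 a p = Blinfun (\<lambda>v. cnj (fst p) * fst v / a + cnj (snd p) * snd v / (1 - a))"

lemma alpha0_apply:
  "blinfun_apply (alpha0 a p) v = cnj (fst p) * fst v / a + cnj (snd p) * snd v / (1 - a)"
proof -
  have "linear (\<lambda>v::C2. cnj (fst p) * fst v / a + cnj (snd p) * snd v / (1 - a))"
    by (rule linearI) (simp_all add: scaleR_conv_of_real ring_distribs add_divide_distrib mult_ac)
  then show ?thesis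
    unfolding alpha0_def by (subst bounded_linear_Blinfun_apply) (simp_all add: linear_conv_bounded_linear)
qed

lemma linear_alpha0: "linear (alpha0 a)"
  by (rule linearI; rule blinfun_eqI)
     (simp_all add: alpha0_apply blinfun.add_left blinfun.scaleR_left scaleR_conv_of_real ring_distribs add_divide_distrib mult_ac)

lemma linear_omega: "linear (omega a)"
  by (rule linearI; rule blinfun_eqI)
     (simp_all add: omega_apply blinfun.add_left blinfun.scaleR_left scaleR_conv_of_real algebra_simps)

lemma smooth_form_linear:
  fixes \<alpha> :: "C2 form1"
  assumes "linear \<alpha>" shows "smooth_form M \<alpha>"
  unfolding smooth_form_def smooth_on_def
  by (intro exI[of _ UNIV] conjI allI Ck_on_linear assms) auto

lemma ext_deriv_linear:
  fixes \<alpha> :: "C2 form1"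
  assumes "linear \<alpha>" shows "ext_deriv \<alpha> p u v = \<alpha> u v - \<alpha> v u"
proof -
  have "(\<alpha> has_derivative \<alpha>) (at p)"
    using assms by (intro bounded_linear_imp_has_derivative) (simp add: linear_conv_bounded_linear)
  then show ?thesis
    unfolding ext_deriv_def by (simp add: frechet_derivative_at[symmetric])
qed

lemma ext_deriv_omega: "ext_deriv (omega a) p u v = fst u * snd v - snd u * fst v"
  by (simp add: ext_deriv_linear[OF linear_omega] omega_apply algebra_simps)

lemma S3_cnj: "p \<in> S3 \<Longrightarrow> fst p * cnj (fst p) + snd p * cnj (snd p) = 1"
  by (simp add: norm_eq_1 inner_prod_def inner_complex_def complex_eq_iff algebra_simps)

lemma param_set_nonzero: "a \<in> param_set \<Longrightarrow> a \<noteq> 0 \<and> 1 - a \<noteq> 0"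
  by (auto simp: param_set_def)

text \<open>
  For \<open>0 < a < 1\<close> this is a convex combination of \<open>a\<close> and \<open>1 - a\<close>. Otherwise the imaginary part
  can only vanish for \<open>\<bar>z\<^sub>1\<bar> = \<bar>z\<^sub>2\<bar>\<close>, and then the value is 1/2.
\<close>

lemma omega_J2_nonzero:
  assumes a: "a \<in> param_set" and p: "p \<in> S3"
  shows "omega_J2 a p \<noteq> 0"
proof
  assume h: "omega_J2 a p = 0"
  define x where "x = (cmod (fst p))\<^sup>2"
  define y where "y = (cmod (snd p))\<^sup>2"
  have xy: "fst p * cnj (fst p) = of_real x" "snd p * cnj (snd p) = of_real y"
    unfolding x_def y_def by (simp_all only: complex_norm_square)
  have pos: "0 \<le> x" "0 \<le> y" by (simp_all add: x_def y_def)
  have "complex_of_real (x + y) = 1" using S3_cnj[OF p] by (simp add: xy)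
  then have sum: "x + y = 1" by (metis of_real_eq_1_iff)
  have re: "Re a * x + (1 - Re a) * y = 0" and im: "Im a * (x - y) = 0"
    using h by (simp_all add: omega_J2_def xy complex_eq_iff algebra_simps)
  show False
  proof (cases "Im a = 0")
    case True
    then have a01: "0 < Re a" "Re a < 1"
      using a by (auto simp: param_set_def complex_is_Real_iff)
    then have "0 \<le> Re a * x" "0 \<le> (1 - Re a) * y" using pos by simp_all
    with re have "Re a * x = 0" "(1 - Re a) * y = 0" by linarith+
    then show False using a01 sum by simp
  next
    case False
    then have "x = y" using im by simp
    then show False using re sum by (simp add: algebra_simps)
  qed
qed

lemma omega_frame:
  "omega a p (J1 p) = \<i> * (2 * a - 1) * fst p * snd p"
  "omega a p (J2 p) = omega_J2 a p"
  "omega a p (J3 p) = \<i> * omega_J2 a p"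
  by (simp_all add: omega_apply omega_J2_def J1_def J2_def J3_def algebra_simps)

text \<open>
  The values \<open>h\<close> and \<open>\<i> h\<close> on \<open>J2 p\<close> and \<open>J3 p\<close> are independent over the reals because \<open>h \<noteq> 0\<close>.
  Integrability is clear because \<open>\<omega> \<and> d\<omega>\<close> is a 3-form in the two differentials \<open>dz\<^sub>1, dz\<^sub>2\<close>.
\<close>

lemma formally_integrable_omega:
  assumes "a \<in> param_set"
  shows "formally_integrable S3 (omega a)"
  unfolding formally_integrable_def
proof (intro conjI ballI allI impI)
  show "smooth_form S3 (omega a)" by (rule smooth_form_linear[OF linear_omega])
  fix p assume p: "p \<in> S3"
  have "s = 0 \<and> t = 0" if *: "\<forall>v\<in>tangent_space S3 p. s * Re (omega a p v) + t * Im (omega a p v) = 0" for s t :: real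
  proof -
    let ?h = "omega_J2 a p"
    have "s * Re ?h + t * Im ?h = 0"
      using *[rule_format, OF complex_structure_in_tangent_space[OF complex_structures(2) p]]
      by (simp add: omega_frame)
    moreover have "- s * Im ?h + t * Re ?h = 0"
      using *[rule_format, OF complex_structure_in_tangent_space[OF complex_structures(3) p]]
      by (simp add: omega_frame)
    ultimately have "Complex s (- t) * ?h = 0"
      by (simp add: complex_eq_iff algebra_simps)
    with omega_J2_nonzero[OF assms p] have "Complex s (- t) = 0" by (metis mult_eq_0_iff)
    then show ?thesis by (simp add: complex_eq_iff)
  qed
  then show "\<And>s t. \<forall>v\<in>tangent_space S3 p. s * Re (omega a p v) + t * Im (omega a p v) = 0 \<Longrightarrow> s = 0"
    "\<And>s t. \<forall>v\<in>tangent_space S3 p. s * Re (omega a p v) + t * Im (omega a p v) = 0 \<Longrightarrow> t = 0"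
    by blast+
  show "wedge12 (omega a) (ext_deriv (omega a)) p u v w = 0" for u v w
    by (simp add: wedge12_def ext_deriv_omega omega_apply algebra_simps)
qed

lemma alpha0_omega:
  assumes "a \<in> param_set" "p \<in> S3"
  shows "ext_deriv (omega a) p u v = wedge11 (alpha0 a) (omega a) p u v"
proof -
  have a: "a \<noteq> 0" "1 - a \<noteq> 0" using param_set_nonzero[OF assms(1)] by auto
  have "(cnj z * u1 * b + cnj w * u2 * c) * (a * z * v2 - a' * w * v1)
      - (cnj z * v1 * b + cnj w * v2 * c) * (a * z * u2 - a' * w * u1)
      = ((a * b) * (z * cnj z) + (a' * c) * (w * cnj w)) * (u1 * v2 - u2 * v1)" for z w u1 u2 v1 v2 a' b c
    by (simp add: algebra_simps)
  note this[of "fst p" "fst u" "inverse a" "snd p" "snd u" "inverse (1 - a)" "snd v" "1 - a" "fst v"]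
  then have "wedge11 (alpha0 a) (omega a) p u v =
      (fst p * cnj (fst p) + snd p * cnj (snd p)) * (fst u * snd v - snd u * fst v)"
    unfolding wedge11_def alpha0_apply omega_apply divide_inverse using a by simp
  then show ?thesis using S3_cnj[OF assms(2)] by (simp add: ext_deriv_omega)
qed

text \<open>
  The function \<open>g\<close> with \<open>\<alpha> \<and> d\<alpha> = g vol\<close> on the sphere.
\<close>

definition bott_density :: "C2 form1 \<Rightarrow> C2 \<Rightarrow> complex" where
  "bott_density \<alpha> p = wedge12 \<alpha> (ext_deriv \<alpha>) p (J1 p) (J2 p) (J3 p)"

lemma bott_density_alpha0:
  assumes "p \<in> S3"
  shows "bott_density (alpha0 a) p = - 2 / (a * (1 - a))"
proof -
  define b where "b = inverse a"
  define c where "c = inverse (1 - a)"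
  have "bott_density (alpha0 a) p = - 2 * b * c * (fst p * cnj (fst p) + snd p * cnj (snd p))\<^sup>2"
    unfolding bott_density_def wedge12_def ext_deriv_linear[OF linear_alpha0] alpha0_apply divide_inverse
      b_def[symmetric] c_def[symmetric]
    by (simp add: J1_def J2_def J3_def power2_eq_square algebra_simps)
  then show ?thesis using S3_cnj[OF assms] by (simp add: b_def c_def divide_inverse)
qed

lemma represents_form_bott_density:
  assumes "\<And>p. p \<in> S3 \<Longrightarrow> \<alpha> differentiable (at p)"
  shows "represents_form (bott_density \<alpha>) (wedge12 \<alpha> (ext_deriv \<alpha>))"
  unfolding represents_form_def
proof (intro allI impI)
  fix p u v w :: C2
  assume p: "norm p = 1" and uvw: "p \<bullet> u = 0" "p \<bullet> v = 0" "p \<bullet> w = 0"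
  have L: "linear (blinfun_apply (\<alpha> p))"
    using blinfun.bounded_linear_right bounded_linear.linear by blast
  have D: "linear (frechet_derivative \<alpha> (at p))"
    using assms[of p] p by (intro linear_frechet_derivative) simp
  have B: "linear (ext_deriv \<alpha> p x)" for x
    by (rule linearI)
       (simp_all add: ext_deriv_def linear_add[OF D] linear_scale[OF D] blinfun.add_left blinfun.add_right
         blinfun.scaleR_left blinfun.scaleR_right algebra_simps)
  have anti: "ext_deriv \<alpha> p y x = - ext_deriv \<alpha> p x y" for x y
    by (simp add: ext_deriv_def)
  show "wedge12 \<alpha> (ext_deriv \<alpha>) p u v w = bott_density \<alpha> p * of_real (S3_orientation p u v w)"
    using alternating_frame[OF L B anti p uvw]
    by (simp add: wedge12_def bott_density_def S3_orientation_frame[OF p uvw] mult.commute)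
qed

context
  fixes a :: complex and \<alpha> :: "C2 form1" and U
  assumes a: "a \<in> param_set" and U: "open U" "S3 \<subseteq> U" and \<alpha>: "\<And>k. Ck_on k U \<alpha>"
    and eq: "\<And>p u v. p \<in> S3 \<Longrightarrow> u \<in> tangent_space S3 p \<Longrightarrow> v \<in> tangent_space S3 p \<Longrightarrow>
        ext_deriv (omega a) p u v = wedge11 \<alpha> (omega a) p u v"
begin

lemma alpha_differentiable: "p \<in> S3 \<Longrightarrow> \<alpha> differentiable (at p)"
  using Ck_on_Suc_has_derivative[OF U(1) \<alpha>] U(2) by (intro differentiableI) blast

text \<open>
  The condition \<open>d\<omega> = \<alpha> \<and> \<omega>\<close>, evaluated on the pairs \<open>J2, J3\<close> and \<open>J1, J2\<close> of the frame,
  expresses \<open>\<alpha>\<close> by its value on \<open>J2\<close> alone.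
\<close>

lemma alpha_frame:
  assumes p: "p \<in> S3"
  shows "\<alpha> p (J3 p) = \<i> * \<alpha> p (J2 p)"
    and "\<alpha> p (J1 p) * omega_J2 a p = \<i> + \<alpha> p (J2 p) * (\<i> * (2 * a - 1) * fst p * snd p)"
proof -
  note tan = complex_structures[THEN complex_structure_in_tangent_space, OF p]
  have "ext_deriv (omega a) p (J2 p) (J3 p) = 0"
    by (simp add: ext_deriv_omega J2_def J3_def)
  then have "\<alpha> p (J2 p) * (\<i> * omega_J2 a p) - \<alpha> p (J3 p) * omega_J2 a p = 0"
    using eq[OF p tan(2,3)] by (simp only: wedge11_def omega_frame)
  then have "\<alpha> p (J3 p) * omega_J2 a p = (\<i> * \<alpha> p (J2 p)) * omega_J2 a p"
    by (simp only: right_minus_eq mult_ac)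
  then show "\<alpha> p (J3 p) = \<i> * \<alpha> p (J2 p)"
    using mult_right_cancel[OF omega_J2_nonzero[OF a p]] by blast
  have "ext_deriv (omega a) p (J1 p) (J2 p) = \<i> * (fst p * cnj (fst p) + snd p * cnj (snd p))"
    by (simp add: ext_deriv_omega J2_def J1_def algebra_simps)
  then have "ext_deriv (omega a) p (J1 p) (J2 p) = \<i>"
    using S3_cnj[OF p] by simp
  then show "\<alpha> p (J1 p) * omega_J2 a p = \<i> + \<alpha> p (J2 p) * (\<i> * (2 * a - 1) * fst p * snd p)"
    using eq[OF p tan(1,2)] by (simp add: wedge11_def omega_frame algebra_simps)
qed

lemma alpha_structure_has_derivative:
  assumes p: "p \<in> U" and J: "linear J"
  shows "((\<lambda>q. \<alpha> q (J q)) has_derivative (\<lambda>v. \<alpha> p (J v) + frechet_derivative \<alpha> (at p) v (J p))) (at p)"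
  using J by (intro bounded_bilinear.FDERIV[OF bounded_bilinear_blinfun_apply]
     Ck_on_Suc_has_derivative[OF U(1) \<alpha> p] bounded_linear_imp_has_derivative) (simp add: linear_conv_bounded_linear)

text \<open>
  Put \<open>F = \<alpha>(J2)\<close>, \<open>A1 = \<alpha>(J1)\<close>, \<open>w = \<omega>(J1)\<close>, \<open>h = \<omega>(J2)\<close> and let \<open>D\<close> be the derivation
  along the complex vector field \<open>\<i> J2 - J3\<close>. Since \<open>\<alpha>(J3) = \<i> F\<close>, the derivatives along \<open>J1\<close> and the
  squares of \<open>F\<close> cancel in \<open>\<alpha> \<and> d\<alpha>\<close>, which leaves \<open>A1 DF - F DA1 + 2 A1\<^sup>2\<close>; the last term
  stems from the brackets of the frame. The field \<open>D\<close> kills holomorphic functions, hence \<open>Dw = 0\<close>, and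
  \<open>Dh = -2w\<close>. Eliminating \<open>A1\<close> by \<open>A1 h = \<i> + F w\<close> turns the expression into
  \<open>\<i> D(F / h) - 2 / h\<^sup>2\<close>.
\<close>

lemma bott_density_formula:
  assumes p: "p \<in> S3"
  defines "f \<equiv> \<lambda>q. \<alpha> q (J2 q) * inverse (omega_J2 a q)"
  shows "bott_density \<alpha> p = - 2 / (omega_J2 a p)\<^sup>2 - frechet_derivative f (at p) (J2 p)
     - \<i> * frechet_derivative f (at p) (J3 p)"
proof -
  define h where "h = omega_J2 a p"
  define w where "w = \<i> * (2 * a - 1) * fst p * snd p"
  define D where "D v = frechet_derivative \<alpha> (at p) v" for v
  have h0: "h \<noteq> 0" using omega_J2_nonzero[OF a p] by (simp add: h_def)
  have pU: "p \<in> U" using p U by blast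
  note lin = complex_structures[THEN complex_structure_linear]
  define A1 where "A1 = \<alpha> p (J1 p)"
  define F where "F = \<alpha> p (J2 p)"
  define E1 where "E1 v = \<alpha> p (J1 v) + D v (J1 p)" for v
  define E2 where "E2 v = \<alpha> p (J2 v) + D v (J2 p)" for v
  define E3 where "E3 v = \<alpha> p (J3 v) + D v (J3 p)" for v
  have d1: "((\<lambda>q. \<alpha> q (J1 q)) has_derivative E1) (at p)"
    and d2: "((\<lambda>q. \<alpha> q (J2 q)) has_derivative E2) (at p)"
    and d3: "((\<lambda>q. \<alpha> q (J3 q)) has_derivative E3) (at p)"
    unfolding E1_def E2_def E3_def D_def by (intro alpha_structure_has_derivative[OF pU] lin)+
  define h' where "h' v = a * (fst p * cnj (fst v) + fst v * cnj (fst p))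
      + (1 - a) * (snd p * cnj (snd v) + snd v * cnj (snd p))" for v
  define w' where "w' v = \<i> * (2 * a - 1) * (fst p * snd v + fst v * snd p)" for v
  have dh: "(omega_J2 a has_derivative h') (at p)"
    unfolding omega_J2_def[abs_def] h'_def by (auto intro!: derivative_eq_intros)
  have dw: "((\<lambda>q. \<i> * (2 * a - 1) * fst q * snd q) has_derivative w') (at p)"
    unfolding w'_def by (auto intro!: derivative_eq_intros simp: algebra_simps)
  have r0: "\<alpha> p (J3 p) = \<i> * F" "A1 * h = \<i> + F * w"
    using alpha_frame[OF p] by (simp_all add: F_def A1_def h_def w_def)
  have "((\<lambda>q. \<i> * \<alpha> q (J2 q)) has_derivative (\<lambda>v. \<i> * E2 v)) (at p)"
    by (rule has_derivative_mult_right[OF d2])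
  then have r3: "E3 (J p) = \<i> * E2 (J p)" if "orthogonal_complex_structure J" for J
    using derivative_cong_on_sphere[OF that p alpha_frame(1) d3] by blast
  have "((\<lambda>q. \<alpha> q (J1 q) * omega_J2 a q) has_derivative (\<lambda>v. A1 * h' v + E1 v * h)) (at p)"
    unfolding A1_def h_def by (rule has_derivative_mult[OF d1 dh])
  moreover have "((\<lambda>q. \<i> + \<alpha> q (J2 q) * (\<i> * (2 * a - 1) * fst q * snd q)) has_derivative
      (\<lambda>v. 0 + (F * w' v + E2 v * w))) (at p)"
    unfolding F_def w_def by (intro has_derivative_add has_derivative_const has_derivative_mult d2 dw)
  ultimately have r1: "A1 * h' (J p) + E1 (J p) * h = F * w' (J p) + E2 (J p) * w"
    if "orthogonal_complex_structure J" for J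
    using derivative_cong_on_sphere[OF that p alpha_frame(2)] by fastforce
  then have r1': "E1 (J p) * h = F * w' (J p) + E2 (J p) * w - A1 * h' (J p)"
    if "orthogonal_complex_structure J" for J
    using that by (metis add_diff_cancel_left')
  \<comment> \<open>The derivatives of \<open>F\<close> and \<open>A1\<close> along \<open>\<i> J2 - J3\<close>.\<close>
  define DF where "DF = \<i> * E2 (J2 p) - E2 (J3 p)"
  define DA where "DA = \<i> * E1 (J2 p) - E1 (J3 p)"
  have Dh: "\<i> * h' (J2 p) - h' (J3 p) = - 2 * w"
    by (simp add: h'_def w_def J2_def J3_def algebra_simps)
  have Dw: "\<i> * w' (J2 p) - w' (J3 p) = 0"
    by (simp add: w'_def J2_def J3_def algebra_simps)
  have DAh: "DA * h = w * DF + 2 * A1 * w"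
  proof -
    have "DA * h = \<i> * (E1 (J2 p) * h) - E1 (J3 p) * h" by (simp add: DA_def algebra_simps)
    also have "\<dots> = \<i> * (F * w' (J2 p) + E2 (J2 p) * w - A1 * h' (J2 p))
        - (F * w' (J3 p) + E2 (J3 p) * w - A1 * h' (J3 p))"
      unfolding r1'[OF complex_structures(2)] r1'[OF complex_structures(3)] ..
    also have "\<dots> = F * (\<i> * w' (J2 p) - w' (J3 p)) + w * DF - A1 * (\<i> * h' (J2 p) - h' (J3 p))"
      by (simp add: DF_def algebra_simps)
    finally show ?thesis by (simp add: Dh Dw)
  qed
  have dens: "bott_density \<alpha> p = A1 * DF - F * DA + 2 * A1\<^sup>2"
  proof -
    have neg: "\<alpha> p (- v) = - \<alpha> p v" for v by (rule blinfun.minus_right)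
    have 1: "ext_deriv \<alpha> p (J2 p) (J3 p) = E3 (J2 p) - E2 (J3 p) + 2 * A1"
      and 2: "ext_deriv \<alpha> p (J1 p) (J3 p) = E3 (J1 p) - E1 (J3 p) - 2 * F"
      and 3: "ext_deriv \<alpha> p (J1 p) (J2 p) = E2 (J1 p) - E1 (J2 p) + 2 * (\<i> * F)"
      by (simp_all add: ext_deriv_def E1_def E2_def E3_def D_def quaternion_relations neg A1_def F_def r0(1)[unfolded F_def])
    show ?thesis
      unfolding bott_density_def wedge12_def 1 2 3 r0(1) A1_def[symmetric] F_def[symmetric]
        r3[OF complex_structures(1)] r3[OF complex_structures(2)]
      by (simp add: DF_def DA_def power2_eq_square algebra_simps)
  qed
  have df: "(f has_derivative (\<lambda>v. (E2 v * h - F * h' v) / h\<^sup>2)) (at p)"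
  proof -
    have "(f has_derivative (\<lambda>v. F * (- (inverse h * h' v * inverse h)) + E2 v * inverse h)) (at p)"
      unfolding f_def F_def h_def
      by (intro has_derivative_mult d2 Deriv.has_derivative_inverse[OF _ dh] omega_J2_nonzero[OF a p])
    then show ?thesis
      by (rule has_derivative_eq_rhs) (use h0 in \<open>auto simp: fun_eq_iff power2_eq_square field_simps\<close>)
  qed
  have "- 2 / h\<^sup>2 - (E2 (J2 p) * h - F * h' (J2 p)) / h\<^sup>2 - \<i> * ((E2 (J3 p) * h - F * h' (J3 p)) / h\<^sup>2)
      = (- 2 + \<i> * h * DF - \<i> * F * (\<i> * h' (J2 p) - h' (J3 p))) / h\<^sup>2"
    by (simp add: DF_def algebra_simps add_divide_distrib diff_divide_distrib)
  also have "\<dots> = (- 2 + \<i> * h * DF + 2 * \<i> * F * w) / h\<^sup>2"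
    unfolding Dh by simp
  also have "\<dots> = A1 * DF - F * DA + 2 * A1\<^sup>2"
  proof -
    have "(A1 * DF - F * DA + 2 * A1\<^sup>2) * h\<^sup>2 = (A1 * h) * h * DF - F * h * (DA * h) + 2 * (A1 * h)\<^sup>2"
      by (simp add: power2_eq_square algebra_simps)
    also have "\<dots> = (A1 * h) * h * DF - F * w * h * DF - 2 * F * w * (A1 * h) + 2 * (A1 * h)\<^sup>2"
      unfolding DAh by (simp add: algebra_simps)
    also have "\<dots> = - 2 + \<i> * h * DF + 2 * \<i> * F * w"
      unfolding r0(2) by (simp add: power2_eq_square algebra_simps)
    finally show ?thesis using h0 by (simp add: field_simps)
  qed
  finally show ?thesis
    unfolding dens frechet_derivative_at[OF df, symmetric] h_def by simp
qed

lemma continuous_on_bott_density: "continuous_on S3 (bott_density \<alpha>)"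
proof -
  note lin = complex_structures[THEN complex_structure_linear]
  have J: "continuous_on X J1" "continuous_on X J2" "continuous_on X J3" for X
    using lin by (auto intro!: linear_continuous_on simp: linear_conv_bounded_linear)
  have A: "continuous_on U \<alpha>" using \<alpha> Ck_on_imp_continuous_on by blast
  have "continuous_on U (bott_density \<alpha>)"
    unfolding bott_density_def[abs_def] wedge12_def ext_deriv_def
    by (intro continuous_intros A J continuous_on_frechet_derivative[OF U(1) \<alpha>])
  then show ?thesis using U(2) continuous_on_subset by blast
qed

text \<open>
  The right-hand side does not involve \<open>\<alpha>\<close>: this is the independence of the Bott invariant of the
  choice of \<open>\<alpha>\<close>.
\<close>

lemma sphere_integral_bott_density:
  "sphere_integral (bott_density \<alpha>) = sphere_integral (\<lambda>p. - 2 / (omega_J2 a p)\<^sup>2)"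
proof -
  let ?f = "\<lambda>q. \<alpha> q (J2 q) * inverse (omega_J2 a q)"
  define W where "W = U \<inter> {q. omega_J2 a q \<noteq> 0}"
  have conth: "continuous_on X (omega_J2 a)" for X
    unfolding omega_J2_def[abs_def] by (intro continuous_intros)
  have W: "open W" "S3 \<subseteq> W"
    unfolding W_def using U omega_J2_nonzero[OF a] by (auto intro!: open_Int open_Collect_neq conth)
  have Ckh: "Ck_on k X (omega_J2 a)" if "open X" for k and X :: "C2 set"
  proof -
    have l: "Ck_on k X (\<lambda>p::C2. fst p)" "Ck_on k X (\<lambda>p::C2. snd p)"
      "Ck_on k X (\<lambda>p::C2. cnj (fst p))" "Ck_on k X (\<lambda>p::C2. cnj (snd p))"
      using that by (intro Ck_on_linear; simp add: linear_iff)+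
    show ?thesis
      unfolding omega_J2_def[abs_def] by (intro Ck_on_add Ck_on_mult Ck_on_const that l)
  qed
  have f: "Ck_on (Suc 0) W ?f"
  proof (intro Ck_on_mult Ck_on_blinfun_apply Ck_on_inverse W(1) Ckh)
    show "Ck_on (Suc 0) W \<alpha>"
      using Ck_on_subset[OF W(1) _ \<alpha>] by (simp add: W_def)
    show "Ck_on (Suc 0) W J2"
      by (intro Ck_on_linear W complex_structure_linear complex_structures)
  qed (simp add: W_def)
  let ?D = "\<lambda>J p. frechet_derivative ?f (at p) (J p)"
  have contD: "continuous_on S3 (?D J)" if "orthogonal_complex_structure J" for J
  proof -
    have "continuous_on W J"
      using complex_structure_linear[OF that] by (intro linear_continuous_on) (simp add: linear_conv_bounded_linear)
    then show ?thesis
      using continuous_on_frechet_derivative[OF W(1) f] W(2) continuous_on_subset by blast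
  qed
  have conth2: "continuous_on S3 (\<lambda>p. - 2 / (omega_J2 a p)\<^sup>2)"
    using omega_J2_nonzero[OF a] by (intro continuous_intros conth) auto
  have "sphere_integral (bott_density \<alpha>) =
      sphere_integral (\<lambda>p. - 2 / (omega_J2 a p)\<^sup>2 + ((-1) * ?D J2 p + (- \<i>) * ?D J3 p))"
    by (rule sphere_integral_cong) (simp add: bott_density_formula)
  also have "\<dots> = sphere_integral (\<lambda>p. - 2 / (omega_J2 a p)\<^sup>2)
       + ((-1) * sphere_integral (?D J2) + (- \<i>) * sphere_integral (?D J3))"
    by (simp only: sphere_integral_add sphere_integral_cmul conth2 contD complex_structures
        continuous_on_add continuous_on_mult continuous_on_const)
  also have "\<dots> = sphere_integral (\<lambda>p. - 2 / (omega_J2 a p)\<^sup>2)"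
    by (simp add: sphere_integral_derivative[OF complex_structures(2) W f]
        sphere_integral_derivative[OF complex_structures(3) W f])
  finally show ?thesis .
qed

lemma form_integral_bott:
  "form_integral S3 S3_orientation (wedge12 \<alpha> (ext_deriv \<alpha>)) = sphere_integral (\<lambda>p. - 2 / (omega_J2 a p)\<^sup>2)"
  using form_integral_S3[OF continuous_on_bott_density represents_form_bott_density[OF alpha_differentiable]]
  by (simp add: sphere_integral_bott_density)

end

theorem proposition4p4:
  fixes a :: complex
  assumes "a \<in> param_set"
  shows "bott_invariant S3 S3_orientation (omega a) = - 4 * complex_of_real pi ^ 2 / (a * (1 - a))"
proof -
  let ?c = "- 4 * complex_of_real pi ^ 2 / (a * (1 - a))"
  have Ck: "Ck_on k UNIV (alpha0 a)" for k
    by (intro Ck_on_linear linear_alpha0 open_UNIV)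
  have "sphere_integral (\<lambda>p. - 2 / (omega_J2 a p)\<^sup>2) = sphere_integral (bott_density (alpha0 a))"
    by (rule sphere_integral_bott_density[OF assms open_UNIV subset_UNIV Ck alpha0_omega[OF assms], symmetric])
  also have "\<dots> = sphere_integral (\<lambda>p. - 2 / (a * (1 - a)))"
    by (rule sphere_integral_cong) (rule bott_density_alpha0)
  also have "\<dots> = ?c" by (simp add: sphere_integral_const)
  finally have h_integral: "sphere_integral (\<lambda>p. - 2 / (omega_J2 a p)\<^sup>2) = ?c" .
  have c: "form_integral S3 S3_orientation (wedge12 \<alpha> (ext_deriv \<alpha>)) = ?c"
    if \<alpha>: "smooth_form S3 \<alpha>"
       "\<forall>p\<in>S3. \<forall>u\<in>tangent_space S3 p. \<forall>v\<in>tangent_space S3 p.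
           ext_deriv (omega a) p u v = wedge11 \<alpha> (omega a) p u v" for \<alpha>
  proof -
    obtain U where "S3 \<subseteq> U" "open U" "\<And>k. Ck_on k U \<alpha>"
      using \<alpha>(1) by (auto simp: smooth_form_def smooth_on_def)
    then show ?thesis
      using form_integral_bott[OF assms _ _ _ \<alpha>(2)[rule_format]] h_integral by simp
  qed
  show ?thesis
    unfolding bott_invariant_def
  proof (rule the_equality)
    have "smooth_form S3 (alpha0 a)" by (rule smooth_form_linear[OF linear_alpha0])
    moreover have "\<forall>p\<in>S3. \<forall>u\<in>tangent_space S3 p. \<forall>v\<in>tangent_space S3 p.
        ext_deriv (omega a) p u v = wedge11 (alpha0 a) (omega a) p u v"
      using alpha0_omega[OF assms] by blast
    ultimately show "formally_integrable S3 (omega a) \<and> (\<exists>\<alpha>. smooth_form S3 \<alpha> \<and>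
        (\<forall>p\<in>S3. \<forall>u\<in>tangent_space S3 p. \<forall>v\<in>tangent_space S3 p.
           ext_deriv (omega a) p u v = wedge11 \<alpha> (omega a) p u v) \<and>
        ?c = form_integral S3 S3_orientation (wedge12 \<alpha> (ext_deriv \<alpha>)))"
      using formally_integrable_omega[OF assms] c by metis
  qed (use c in blast)
qed

end
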